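(* Suppose that $h$ does not lie in the span of the principal eigenfunctions, and let $C\in\mathbb{R}^{p\times n}$ be the least-squares projection matrix defined in the context. Suppose that $$\delta_h:=\sup_{x\in\mathbb{R}^n}\|h(x)-C\Phi(x)\|<\infty,\qquad \delta(t):=\sup_{x\in\mathbb{R}^n}\|y(t)-h(x)\|<\infty\quad(t\in[0,T]),$$ and that there are constants $\gamma,\gamma_\Phi>0$ such that $$\mathcal V(x,t)\ge \mathcal V(\hat x(t),t)+\frac{\gamma}{2}\|\hat x(t)-x\|^2,\qquad \mathcal V_\Phi(x,t)\ge \mathcal V_\Phi(\hat x_\Phi(t),t)+\frac{\gamma_\Phi}{2}\|\hat x_\Phi(t)-x\|^2\qquad\forall x,$$ where $\hat x(t)$ and $\hat x_\Phi(t)$ are the minimizers of $\mathcal V(\cdot,t)$ and $\mathcal V_\Phi(\cdot,t)$, respectively. Then for $t\in[0,T]$ and all $x\in\mathbb{R}^n$, $$|\mathcal V(x,t)-\mathcal V_\Phi(x,t)|\le \lambda_{\max}(Q^{-1})\int_0^t\delta_h\Big(\frac{\delta_h}{2}+\delta(\tau)\Big)d\tau=:c(t)$$ and $$\|\hat x(t)-\hat x_\Phi(t)\|\le 2\sqrt{\frac{c(t)}{\gamma_{\min}}},\qquad \gamma_{\min}=\min\{\gamma,\gamma_\Phi\}.$$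
   Context: Setting: $f:\mathbb{R}^n\to\mathbb{R}^n$ and $h:\mathbb{R}^n\to\mathbb{R}^p$ are smooth; the origin is a hyperbolic equilibrium of $\dot x=f(x)$; $R\in\mathbb{R}^{n\times n}$, $Q\in\mathbb{R}^{p\times p}$, $\Sigma\in\mathbb{R}^{n\times n}$ are (symmetric positive definite) covariance matrices; $\mu\in\mathbb{R}^n$; $T>0$; $y:[0,T]\to\mathbb{R}^p$ is the given measurement signal; $\|\cdot\|$ is the Euclidean norm. Principal Koopman eigenfunctions: $\Phi=(\phi_1,\dots,\phi_n)^\top:\mathbb{R}^n\to\mathbb{R}^n$ is a (at least $C^1$) real vector of functions defined on all of $\mathbb{R}^n$ with $\frac{\partial\Phi}{\partial x}(x)f(x)=\Lambda\Phi(x)$ for all $x$, where $\Lambda\in\mathbb{R}^{n\times n}$ is in real Jordan canonical form and its eigenvalues are those of the linearization $\frac{\partial f}{\partial x}(0)$. $\Phi$ is a change of coordinates transforming the nonlinear system to a linear one; in particular $\frac{\partial\Phi}{\partial x}(x)$ is invertible for every $x$. $R_1(x):=\frac{\partial\Phi}{\partial x}(x)^\top R^{-1}\frac{\partial\Phi}{\partial x}(x)$. Optimal value function: for $0\le t\le T$, $\mathcal V(x,t)=\min_{u(\tau),\,0\le\tau\le t}\mathcal J_t[u]$, where $$\mathcal J_t[u]=\frac12(\Phi(x(0))-\Phi(\mu))^\top\Sigma^{-1}(\Phi(x(0))-\Phi(\mu))+\frac12\int_0^t\Big[u(\tau)^\top R_1(x(\tau))u(\tau)+(y(\tau)-h(x(\tau)))^\top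 Q^{-1}(y(\tau)-h(x(\tau)))\Big]d\tau,$$ subject to $\dot x(\tau)=f(x(\tau))+u(\tau)$, $x(t)=x$, with $x(0)$ free. It is the (viscosity) solution of $$\frac{\partial \mathcal V}{\partial t}+\frac{\partial \mathcal V}{\partial x}f(x)+\frac12\frac{\partial \mathcal V}{\partial x}R_1(x)^{-1}\Big(\frac{\partial \mathcal V}{\partial x}\Big)^{\top}-\frac12(y(t)-h(x))^\top Q^{-1}(y(t)-h(x))=0,$$ with $\mathcal V(x,0)=\frac12(\Phi(x)-\Phi(\mu))^\top\Sigma^{-1}(\Phi(x)-\Phi(\mu))$. Projection matrix $C$: its rows $c_i^\top$, $i=1,\dots,p$, are the solutions of $\min_{c_i\in\mathbb{R}^n}\langle h_i-c_i^\top\Phi,\,h_i-c_i^\top\Phi\rangle$, where $\langle a,b\rangle=\int_{\mathbb{R}^n}a(x)b(x)\,dx$. Approximate value function: $\mathcal V_\Phi(x,t)=\frac12\Phi(x)^\top P(t)\Phi(x)+s(t)^\top\Phi(x)+r(t)$, where on $[0,T]$ $$\dot P+\Lambda^\top P+P\Lambda+PRP-C^\top Q^{-1}C=0,\quad \dot s+\Lambda^\top s+PRs+C^\top Q^{-1}y=0,\quad \dot r+\tfrac12 s^\top Rs-\tfrac12 y^\top Q^{-1}y=0,$$ with $P(0)=\Sigma^{-1}$, $s(0)=-\Sigma^{-1}\Phi(\mu)$, $r(0)=\frac12\Phi(\mu)^\top\Sigma^{-1}\Phi(\mu)$. *)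

theory Defs
  imports "HOL-Analysis.Analysis" "HOL-Computational_Algebra.Polynomial"
begin

primrec Ck :: "nat \<Rightarrow> ('a::real_normed_vector \<Rightarrow> 'b::real_normed_vector) \<Rightarrow> bool" where
  "Ck 0 F \<longleftrightarrow> continuous_on UNIV F"
| "Ck (Suc k) F \<longleftrightarrow>
     (\<forall>x. F differentiable (at x)) \<and> (\<forall>v. Ck k (\<lambda>x. frechet_derivative F (at x) v))"

definition smooth :: "('a::real_normed_vector \<Rightarrow> 'b::real_normed_vector) \<Rightarrow> bool" where
  "smooth F \<longleftrightarrow> (\<forall>k. Ck k F)"

definition pos_def :: "real^'n^'n \<Rightarrow> bool" where
  "pos_def A \<longleftrightarrow> transpose A = A \<and> (\<forall>v. v \<noteq> 0 \<longrightarrow> v \<bullet> (A *v v) > 0)"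

definition charpoly :: "'a::idom^'n^'n \<Rightarrow> 'a poly" where
  "charpoly A = det (mat [:0, 1:] - map_matrix (\<lambda>a. [:a:]) A)"

text \<open>Complex eigenvalues of a real matrix, counted with algebraic multiplicity.\<close>

definition eigenvalues :: "real^'n^'n \<Rightarrow> complex multiset" where
  "eigenvalues A = proots (charpoly (map_matrix complex_of_real A))"

text \<open>Used for symmetric matrices only: their eigenvalues are all real, so the maximum is taken
  over a nonempty finite set.\<close>

definition lambda_max :: "real^'n^'n \<Rightarrow> real" where
  "lambda_max A = Max (set_mset (proots (charpoly A)))"

definition hyperbolic_equilibrium :: "(real^'n \<Rightarrow> real^'n) \<Rightarrow> real^'n \<Rightarrow> bool" where
  "hyperbolic_equilibrium f x \<longleftrightarrow>
     f x = 0 \<and> (\<forall>z \<in># eigenvalues (jacobian f (at x)). Re z \<noteq> 0)"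

text \<open>\<open>RealBlock l m\<close> is the \<open>m\<close>-by-\<open>m\<close> Jordan block with eigenvalue \<open>l\<close>;
  \<open>ComplexBlock a b m\<close> is the real \<open>2m\<close>-by-\<open>2m\<close> Jordan block of the conjugate pair
  \<open>a \<plusminus> b\<i>\<close>, with 2-by-2 blocks with rows \<open>(a, b)\<close> and \<open>(-b, a)\<close> on the diagonal and 2-by-2
  identity blocks above it. Entries are indexed from 0.\<close>

datatype jordan_cell = RealBlock real nat | ComplexBlock real real nat

fun cell_size :: "jordan_cell \<Rightarrow> nat" where
  "cell_size (RealBlock l m) = m"
| "cell_size (ComplexBlock a b m) = 2 * m"

fun valid_cell :: "jordan_cell \<Rightarrow> bool" where
  "valid_cell (RealBlock l m) \<longleftrightarrow> m \<ge> 1"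
| "valid_cell (ComplexBlock a b m) \<longleftrightarrow> m \<ge> 1 \<and> b \<noteq> 0"

fun cell_entry :: "jordan_cell \<Rightarrow> nat \<Rightarrow> nat \<Rightarrow> real" where
  "cell_entry (RealBlock l m) i j = (if i = j then l else if j = i + 1 then 1 else 0)"
| "cell_entry (ComplexBlock a b m) i j =
     (if i div 2 = j div 2 then (if i = j then a else if i < j then b else - b)
      else if j = i + 2 then 1 else 0)"

fun block_diag_entry :: "jordan_cell list \<Rightarrow> nat \<Rightarrow> nat \<Rightarrow> real" where
  "block_diag_entry [] i j = 0"
| "block_diag_entry (B # Bs) i j =
     (if i < cell_size B \<and> j < cell_size B then cell_entry B i j
      else if i \<ge> cell_size B \<and> j \<ge> cell_size B
           then block_diag_entry Bs (i - cell_size B) (j - cell_size B)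
      else 0)"

text \<open>A finite index type carries no order, so the numbering \<open>e\<close> of the coordinates in which the
  matrix has Jordan form is existentially quantified.\<close>

definition real_jordan_form :: "real^'n^'n \<Rightarrow> bool" where
  "real_jordan_form A \<longleftrightarrow>
     (\<exists>Bs (e :: 'n \<Rightarrow> nat).
        bij_betw e UNIV {..<CARD('n)} \<and>
        (\<forall>B \<in> set Bs. valid_cell B) \<and> sum_list (map cell_size Bs) = CARD('n) \<and>
        (\<forall>i j. A $ i $ j = block_diag_entry Bs (e i) (e j)))"

text \<open>Being a change of coordinates is expressed by injectivity together with invertibility of
  the Jacobian; surjectivity is not required.\<close>

definition principal_eigenfunctions ::
  "(real^'n \<Rightarrow> real^'n) \<Rightarrow> real^'n^'n \<Rightarrow> (real^'n \<Rightarrow> real^'n) \<Rightarrow> bool" where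
  "principal_eigenfunctions f \<Lambda> \<Phi> \<longleftrightarrow>
     Ck 1 \<Phi> \<and>
     (\<forall>x. jacobian \<Phi> (at x) *v f x = \<Lambda> *v \<Phi> x) \<and>
     real_jordan_form \<Lambda> \<and>
     eigenvalues \<Lambda> = eigenvalues (jacobian f (at 0)) \<and>
     inj \<Phi> \<and> (\<forall>x. invertible (jacobian \<Phi> (at x)))"

definition R1 :: "(real^'n \<Rightarrow> real^'n) \<Rightarrow> real^'n^'n \<Rightarrow> real^'n \<Rightarrow> real^'n^'n" where
  "R1 \<Phi> R x = transpose (jacobian \<Phi> (at x)) ** matrix_inv R ** jacobian \<Phi> (at x)"

text \<open>\<open>z\<close> solves \<open>z' = g\<close> on \<open>[0, T]\<close> in the Caratheodory (integral) sense; for continuous \<open>g\<close>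
  this is the classical notion.\<close>

definition integral_solution ::
  "real \<Rightarrow> (real \<Rightarrow> 'a::euclidean_space) \<Rightarrow> (real \<Rightarrow> 'a) \<Rightarrow> bool" where
  "integral_solution T g z \<longleftrightarrow> (\<forall>\<tau>\<in>{0..T}. (g has_integral (z \<tau> - z 0)) {0..\<tau>})"

definition running_cost ::
  "(real^'n \<Rightarrow> real^'p) \<Rightarrow> (real \<Rightarrow> real^'p) \<Rightarrow> (real^'n \<Rightarrow> real^'n) \<Rightarrow>
   real^'n^'n \<Rightarrow> real^'p^'p \<Rightarrow> (real \<Rightarrow> real^'n) \<Rightarrow> (real \<Rightarrow> real^'n) \<Rightarrow> real \<Rightarrow> real" where
  "running_cost h y \<Phi> R Q u x \<tau> =
     u \<tau> \<bullet> (R1 \<Phi> R (x \<tau>) *v u \<tau>) +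
     (y \<tau> - h (x \<tau>)) \<bullet> (matrix_inv Q *v (y \<tau> - h (x \<tau>)))"

definition cost ::
  "(real^'n \<Rightarrow> real^'p) \<Rightarrow> (real \<Rightarrow> real^'p) \<Rightarrow> (real^'n \<Rightarrow> real^'n) \<Rightarrow>
   real^'n^'n \<Rightarrow> real^'p^'p \<Rightarrow> real^'n^'n \<Rightarrow> real^'n \<Rightarrow>
   real \<Rightarrow> (real \<Rightarrow> real^'n) \<Rightarrow> (real \<Rightarrow> real^'n) \<Rightarrow> real" where
  "cost h y \<Phi> R Q \<Sigma> \<mu> t u x =
     1/2 * ((\<Phi> (x 0) - \<Phi> \<mu>) \<bullet> (matrix_inv \<Sigma> *v (\<Phi> (x 0) - \<Phi> \<mu>))) +
     1/2 * integral {0..t} (running_cost h y \<Phi> R Q u x)"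

text \<open>The value function ranges over all controls of finite cost. The running cost is nonnegative,
  so its integrability on \<open>[0, t]\<close> is exactly finiteness of the cost; it makes \<open>u\<close>
  square integrable, \<open>R1\<close> being bounded below along the trajectory. The initial point \<open>x 0\<close> is free.\<close>

definition value_function ::
  "(real^'n \<Rightarrow> real^'n) \<Rightarrow> (real^'n \<Rightarrow> real^'p) \<Rightarrow> (real \<Rightarrow> real^'p) \<Rightarrow> (real^'n \<Rightarrow> real^'n) \<Rightarrow>
   real^'n^'n \<Rightarrow> real^'p^'p \<Rightarrow> real^'n^'n \<Rightarrow> real^'n \<Rightarrow> real^'n \<Rightarrow> real \<Rightarrow> real" where
  "value_function f h y \<Phi> R Q \<Sigma> \<mu> \<xi> t =
     Inf {cost h y \<Phi> R Q \<Sigma> \<mu> t u x | u x.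
            integral_solution t (\<lambda>\<tau>. f (x \<tau>) + u \<tau>) x \<and> x t = \<xi> \<and>
            running_cost h y \<Phi> R Q u x integrable_on {0..t}}"

definition L2_inner :: "(real^'n \<Rightarrow> real) \<Rightarrow> (real^'n \<Rightarrow> real) \<Rightarrow> real" where
  "L2_inner a b = (\<integral>x. a x * b x \<partial>lborel)"

text \<open>The minimization is over those \<open>c\<close> for which the residual lies in \<open>L2\<close>: the Bochner
  integral of a non-integrable function is 0, which would make the comparison meaningless.\<close>

definition least_squares_projection ::
  "(real^'n \<Rightarrow> real^'p) \<Rightarrow> (real^'n \<Rightarrow> real^'n) \<Rightarrow> real^'n^'p \<Rightarrow> bool" where
  "least_squares_projection h \<Phi> C \<longleftrightarrow>
     (\<forall>i. is_arg_min
            (\<lambda>c. L2_inner (\<lambda>x. h x $ i - c \<bullet> \<Phi> x) (\<lambda>x. h x $ i - c \<bullet> \<Phi> x))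
            (\<lambda>c. integrable lborel (\<lambda>x. (h x $ i - c \<bullet> \<Phi> x)\<^sup>2))
            (row i C))"

end

theory Submission
  imports Defs
begin

text \<open>In the coordinates \<open>z = \<Phi> x\<close> the dynamics \<open>x' = f x + u\<close> become the linear system
\<open>z' = \<Lambda> z + w\<close> with \<open>w = (D\<Phi> x) u\<close>, and the control penalty becomes the constant quadratic form
\<open>w \<bullet> (R\<inverse> w)\<close>. Only the measurement misfit stays nonlinear. Replacing \<open>h x\<close> by \<open>C z\<close> in it gives a
linear-quadratic problem, whose value function is \<open>v t z = 1/2 z \<bullet> P z + s \<bullet> z + r\<close>; the approximate value
function is \<open>v t (\<Phi> x)\<close>. Everything follows from an exact identity for \<open>v\<close> along an arbitrary trajectory
(\<open>lq_verification_identity\<close>): the increment of \<open>v\<close> is the linear-quadratic running cost minus the integral of the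
square \<open>1/2 e \<bullet> (R\<inverse> e)\<close>, where \<open>e = w - R (P z + s)\<close> is the deviation of the control from the optimal feedback.

Dropping the square bounds \<open>v\<close> from above by the linear-quadratic cost of every admissible control; the
feedback \<open>w = R (P z + s)\<close> attains equality. The linear-quadratic cost and the true cost of one trajectory
differ by at most the bound \<open>c t\<close>, since
\<open>(a + b) \<bullet> (Q\<inverse> (a + b)) - a \<bullet> (Q\<inverse> a)\<close> with \<open>a = y - h x\<close>, \<open>b = h x - C z\<close> is controlled by the largest
eigenvalue of \<open>Q\<inverse>\<close>. The two inequalities give the two sides of the estimate for the value functions
(\<open>cost_lower_bound\<close> and \<open>near_optimal_control\<close>). Evaluating both growth
conditions at the other minimizer and adding them turns it into the estimate for the minimizers.

Three points need care. An admissible control is merely square integrable, so its trajectory is only absolutely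
continuous; the chain rule for such paths is \<open>has_integral_chain_rule\<close>. The feedback
trajectory is found in the \<open>z\<close> coordinates, by solving a linear differential equation backwards from \<open>\<Phi> \<xi>\<close>,
and has to be pulled back to the \<open>x\<close> coordinates, for which \<open>\<Phi>\<close> must be onto. This is a consequence of the
quadratic growth of the approximate value function at time 0, where it equals
\<open>1/2 (\<Phi> x - \<Phi> \<mu>) \<bullet> (\<Sigma>\<inverse> (\<Phi> x - \<Phi> \<mu>))\<close>: growth makes \<open>\<Phi>\<close> proper, so that its open image is also closed
(\<open>surj_of_quadratic_growth\<close>). Finally, the identity needs \<open>P\<close> to be symmetric, which the Riccati equation
preserves (\<open>riccati_symmetric\<close>).\<close>

section \<open>Chain rule along absolutely continuous paths\<close>

text \<open>In finite dimensions, continuity in each direction implies continuity in the operator norm, because finitely many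
basis directions determine the norm up to a constant.\<close>

lemma continuous_derivative_blinfun:
  fixes G :: "'a::euclidean_space \<Rightarrow> 'b::euclidean_space"
  assumes der: "\<And>x. (G has_derivative G' x) (at x)"
    and cont: "\<And>v. continuous_on UNIV (\<lambda>x. G' x v)"
  shows "continuous_on S (\<lambda>x. Blinfun (G' x))"
    and "blinfun_apply (Blinfun (G' x)) = G' x"
proof -
  have eq: "blinfun_apply (Blinfun (G' x)) = G' x" for x
    using der[of x] by (simp add: bounded_linear_Blinfun_apply has_derivative_bounded_linear)
  show "blinfun_apply (Blinfun (G' x)) = G' x" by (rule eq)
  show "continuous_on S (\<lambda>x. Blinfun (G' x))"
    by (rule continuous_on_blinfun_componentwise)
       (simp add: eq, rule continuous_on_subset[OF cont], simp)
qed

text \<open>The derivative is uniformly continuous on the ball, and the mean value inequality compares \<open>G\<close> with its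
linearization along a short segment, which stays in the ball by convexity.\<close>

lemma uniform_linearization:
  fixes G :: "'a::euclidean_space \<Rightarrow> 'b::euclidean_space"
  assumes der: "\<And>x. (G has_derivative G' x) (at x)"
    and cont: "\<And>v. continuous_on UNIV (\<lambda>x. G' x v)"
    and e: "e > 0"
  obtains d where "d > 0"
    and "\<And>x y. \<lbrakk>x \<in> cball 0 B; y \<in> cball 0 B; dist x y < d\<rbrakk>
           \<Longrightarrow> norm (G y - G x - G' x (y - x)) \<le> e * norm (y - x)"
proof -
  note bl = continuous_derivative_blinfun[OF der cont]
  have "uniformly_continuous_on (cball 0 B) (\<lambda>x. Blinfun (G' x))"
    by (intro compact_uniformly_continuous bl compact_cball)
  then obtain d where d: "d > 0"
    and ud: "\<And>x y. \<lbrakk>x \<in> cball 0 B; y \<in> cball 0 B; dist y x < d\<rbrakk>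
          \<Longrightarrow> dist (Blinfun (G' y)) (Blinfun (G' x)) < e"
    using e by (rule uniformly_continuous_onE) blast
  show thesis
  proof (rule that[OF d])
    fix x y :: 'a assume x: "x \<in> cball 0 B" and y: "y \<in> cball 0 B" and xy: "dist x y < d"
    have "norm (G y - G x - G' x (y - x)) \<le> norm (y - x) * e"
    proof (rule differentiable_bound_linearization[where S = "cball 0 B \<inter> ball x d"])
      fix t :: real assume t: "t \<in> {0..1}"
      have "convex (cball 0 B \<inter> ball x d)" by (intro convex_Int convex_cball convex_ball)
      moreover have "x + t *\<^sub>R (y - x) = (1 - t) *\<^sub>R x + t *\<^sub>R y" by (simp add: algebra_simps)
      ultimately show "x + t *\<^sub>R (y - x) \<in> cball 0 B \<inter> ball x d"
        using x y xy d t by (simp only:) (rule convexD_alt, auto)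
    next
      fix z assume "z \<in> cball 0 B \<inter> ball x d"
      then show "(G has_derivative G' z) (at z within cball 0 B \<inter> ball x d)"
        using der has_derivative_at_withinI by blast
    next
      fix z assume z: "z \<in> cball 0 B \<inter> ball x d"
      then have "norm (Blinfun (G' z) - Blinfun (G' x)) < e"
        using ud[of x z] x by (simp add: dist_norm norm_minus_commute)
      moreover have "norm (Blinfun (G' z) - Blinfun (G' x)) = onorm (G' z - G' x)"
        by (simp add: norm_blinfun.rep_eq minus_blinfun.rep_eq bl(2) fun_diff_def)
      ultimately show "onorm (G' z - G' x) \<le> e" by simp
    qed (use x d in auto)
    then show "norm (G y - G x - G' x (y - x)) \<le> e * norm (y - x)" by (simp add: mult.commute)
  qed
qed

lemma derivative_bounded_on_cball:
  fixes G :: "'a::euclidean_space \<Rightarrow> 'b::euclidean_space"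
  assumes der: "\<And>x. (G has_derivative G' x) (at x)"
    and cont: "\<And>v. continuous_on UNIV (\<lambda>x. G' x v)"
  obtains K where "K > 0" and "\<And>x v. x \<in> cball 0 B \<Longrightarrow> norm (G' x v) \<le> K * norm v"
proof -
  note bl = continuous_derivative_blinfun[OF der cont]
  have "bounded ((\<lambda>x. Blinfun (G' x)) ` cball 0 B)"
    by (intro compact_imp_bounded compact_continuous_image bl compact_cball)
  then obtain K where K: "K > 0" "\<And>x. x \<in> cball 0 B \<Longrightarrow> norm (Blinfun (G' x)) \<le> K"
    by (auto simp: bounded_pos)
  show thesis
  proof (rule that[OF K(1)])
    fix x v :: 'a assume "x \<in> cball 0 B"
    then show "norm (G' x v) \<le> K * norm v"
      using norm_blinfun[of "Blinfun (G' x)" v] K(2)[of x]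
      by (simp add: bl(2)) (meson mult_right_mono norm_ge_zero order_trans)
  qed
qed

lemma path_increment:
  fixes x g :: "real \<Rightarrow> 'a::euclidean_space"
  assumes x: "\<And>\<tau>. \<tau> \<in> {a..b} \<Longrightarrow> (g has_integral (x \<tau> - x a)) {a..\<tau>}"
    and cd: "a \<le> c" "c \<le> d" "d \<le> b"
  shows "(g has_integral (x d - x c)) {c..d}"
proof -
  have d: "(g has_integral (x d - x a)) {a..d}" and c: "(g has_integral (x c - x a)) {a..c}"
    using x cd by auto
  have "g integrable_on {c..d}"
    using d cd by (meson atLeastatMost_subset_iff has_integral_integrable integrable_subinterval_real order_refl)
  then have "(g has_integral integral {c..d} g) {c..d}" by (rule integrable_integral)
  moreover have "(g has_integral (x c - x a + integral {c..d} g)) {a..d}"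
    by (rule has_integral_combine[OF cd(1,2) c calculation])
  then have "x c - x a + integral {c..d} g = x d - x a"
    using d has_integral_unique by blast
  then have "integral {c..d} g = x d - x c" by (simp add: algebra_simps)
  ultimately show ?thesis by simp
qed

lemma path_continuous:
  fixes x g :: "real \<Rightarrow> 'a::euclidean_space"
  assumes x: "\<And>\<tau>. \<tau> \<in> {a..b} \<Longrightarrow> (g has_integral (x \<tau> - x a)) {a..\<tau>}"
  shows "continuous_on {a..b} x"
proof (cases "a \<le> b")
  case True
  have "continuous_on {a..b} (\<lambda>\<tau>. x a + integral {a..\<tau>} g)"
    using x[of b] True by (intro continuous_intros indefinite_integral_continuous_1) auto
  then show ?thesis
    by (rule continuous_on_eq) (use integral_unique[OF x] in auto)
qed simp

text \<open>The path need not be differentiable, so the chain rule is proved from Riemann sums. On a fine tagged division, the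
increment of \<open>G \<circ> x\<close> over an interval tagged \<open>\<tau>\<close> differs from \<open>G' (x \<tau>)\<close> applied to the increment of \<open>x\<close> by at
most a small multiple of the variation of \<open>x\<close> there, and the variations add up to the integral of \<open>norm \<circ> g\<close>.
Henstock's lemma bounds the total difference between the increments of \<open>x\<close> and the terms of the Riemann sum for \<open>g\<close>.\<close>

lemma has_integral_chain_rule:
  fixes x g :: "real \<Rightarrow> 'a::euclidean_space" and G :: "'a \<Rightarrow> 'b::euclidean_space"
  assumes ab: "a \<le> b"
    and g: "g absolutely_integrable_on {a..b}"
    and x: "\<And>\<tau>. \<tau> \<in> {a..b} \<Longrightarrow> (g has_integral (x \<tau> - x a)) {a..\<tau>}"
    and der: "\<And>x. (G has_derivative G' x) (at x)"
    and cont: "\<And>v. continuous_on UNIV (\<lambda>x. G' x v)"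
  shows "((\<lambda>\<tau>. G' (x \<tau>) (g \<tau>)) has_integral (G (x b) - G (x a))) {a..b}"
proof -
  have incr: "(g has_integral (x d - x c)) {c..d}" if "a \<le> c" "c \<le> d" "d \<le> b" for c d
    using path_increment[of a b g x] x that by blast
  have contx: "continuous_on {a..b} x" by (rule path_continuous[OF x])
  then have "bounded (x ` {a..b})" by (intro compact_imp_bounded compact_continuous_image) auto
  then obtain B where B: "\<And>\<tau>. \<tau> \<in> {a..b} \<Longrightarrow> x \<tau> \<in> cball 0 B"
    unfolding bounded_iff by (metis imageI mem_cball_0)
  obtain K where K: "K > 0" "\<And>x v. x \<in> cball 0 B \<Longrightarrow> norm (G' x v) \<le> K * norm v"
    using derivative_bounded_on_cball[where B = B, OF der cont] by blast
  have lin: "linear (G' z)" for z using der has_derivative_linear by blast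
  define M where "M = integral {a..b} (\<lambda>\<tau>. norm (g \<tau>))"
  have gn: "(\<lambda>\<tau>. norm (g \<tau>)) integrable_on {a..b}" and gi: "g integrable_on {a..b}"
    using g by (auto simp: absolutely_integrable_on_def)
  have M: "M \<ge> 0" unfolding M_def by (rule integral_nonneg[OF gn]) auto
  have var: "norm (x d - x c) \<le> integral {c..d} (\<lambda>\<tau>. norm (g \<tau>))"
    if "a \<le> c" "c \<le> d" "d \<le> b" for c d
  proof -
    have "norm (integral {c..d} g) \<le> integral {c..d} (\<lambda>\<tau>. norm (g \<tau>))"
      using that by (intro integral_norm_bound_integral integrable_subinterval_real[OF gi]
          integrable_subinterval_real[OF gn]) auto
    then show ?thesis using integral_unique[OF incr[OF that]] by simp
  qed
  show ?thesis
    unfolding has_integral[of _ _ a b, simplified box_real]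
  proof (intro allI impI)
    fix e :: real assume e: "e > 0"
    \<comment> \<open>\<open>e1\<close> is spent on the linearization and gets multiplied by the variation \<open>M\<close>; \<open>e2\<close> is spent in Henstock's lemma and gets multiplied by \<open>K\<close>.\<close>
    define e1 where "e1 = e / (2 * (M + 1))"
    define e2 where "e2 = e / (2 * (K + 1))"
    have e1: "e1 > 0" and e2: "e2 > 0" using e M K(1) by (auto simp: e1_def e2_def)
    obtain d where d: "d > 0" "\<And>x y. \<lbrakk>x \<in> cball 0 B; y \<in> cball 0 B; dist x y < d\<rbrakk>
           \<Longrightarrow> norm (G y - G x - G' x (y - x)) \<le> e1 * norm (y - x)"
      using uniform_linearization[where B = B, OF der cont e1] by blast
    have "uniformly_continuous_on {a..b} x"
      by (intro compact_uniformly_continuous contx) auto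
    then obtain \<eta> where \<eta>: "\<eta> > 0"
      "\<And>\<sigma> \<tau>. \<lbrakk>\<sigma> \<in> {a..b}; \<tau> \<in> {a..b}; dist \<tau> \<sigma> < \<eta>\<rbrakk> \<Longrightarrow> dist (x \<tau>) (x \<sigma>) < d"
      using d(1) by (rule uniformly_continuous_onE) blast
    obtain \<gamma> where \<gamma>: "gauge \<gamma>" "\<And>p. \<lbrakk>p tagged_partial_division_of (cbox a b); \<gamma> fine p\<rbrakk> \<Longrightarrow>
             (\<Sum>(\<tau>,k)\<in>p. norm (measure lborel k *\<^sub>R g \<tau> - integral k g)) < e2"
      using Henstock_lemma[of g a b e2, unfolded box_real, OF gi e2] unfolding box_real by blast
    have gauge: "gauge (\<lambda>\<tau>. \<gamma> \<tau> \<inter> ball \<tau> \<eta>)"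
      using \<gamma>(1) \<eta>(1) by (intro gauge_Int gauge_ball) auto
    have est: "norm ((\<Sum>(\<tau>,k)\<in>p. measure lborel k *\<^sub>R G' (x \<tau>) (g \<tau>)) - (G (x b) - G (x a))) < e"
      if p: "p tagged_division_of {a..b}" and fine: "(\<lambda>\<tau>. \<gamma> \<tau> \<inter> ball \<tau> \<eta>) fine p" for p
    proof -
      have loc: "norm (measure lborel k *\<^sub>R G' (x \<tau>) (g \<tau>) - (G (x (Sup k)) - G (x (Inf k))))
          \<le> K * norm (measure lborel k *\<^sub>R g \<tau> - integral k g) + e1 * integral k (\<lambda>\<tau>. norm (g \<tau>))"
        if tk: "(\<tau>, k) \<in> p" for \<tau> k
      proof -
        obtain c d' where k: "k = {c..d'}" using tagged_division_ofD(4)[OF p tk] unfolding box_real by blast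
        have tin: "\<tau> \<in> k" and sub: "k \<subseteq> {a..b}" using tagged_division_ofD(2,3)[OF p tk] by auto
        have o: "a \<le> c" "c \<le> \<tau>" "\<tau> \<le> d'" "d' \<le> b" using tin sub k by auto
        have "k \<subseteq> ball \<tau> \<eta>" using fine tk unfolding fine_def by auto
        moreover have "c \<in> k" "d' \<in> k" using o k by auto
        ultimately have "dist c \<tau> < \<eta>" "dist d' \<tau> < \<eta>" by (auto simp: dist_commute)
        then have near: "dist (x \<tau>) (x c) < d" "dist (x \<tau>) (x d') < d"
          using \<eta>(2)[of \<tau> c] \<eta>(2)[of \<tau> d'] o by (auto simp: dist_commute)
        have r: "Sup k = d'" "Inf k = c" using k o by auto
        let ?n = "\<lambda>\<tau>. norm (g \<tau>)"
        have split: "integral {c..\<tau>} ?n + integral {\<tau>..d'} ?n = integral k ?n"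
          unfolding k using o by (intro Henstock_Kurzweil_Integration.integral_combine
              integrable_subinterval_real[OF gn]) auto
        have "norm (G (x d') - G (x \<tau>) - G' (x \<tau>) (x d' - x \<tau>)) \<le> e1 * norm (x d' - x \<tau>)"
          using d(2)[of "x \<tau>" "x d'"] near B o by auto
        also have "\<dots> \<le> e1 * integral {\<tau>..d'} ?n"
          using var[of \<tau> d'] o e1 by simp
        finally have 1: "norm (G (x d') - G (x \<tau>) - G' (x \<tau>) (x d' - x \<tau>)) \<le> e1 * integral {\<tau>..d'} ?n" .
        have "norm (G (x c) - G (x \<tau>) - G' (x \<tau>) (x c - x \<tau>)) \<le> e1 * norm (x c - x \<tau>)"
          using d(2)[of "x \<tau>" "x c"] near B o by auto
        also have "\<dots> \<le> e1 * integral {c..\<tau>} ?n"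
          using var[of c \<tau>] o e1 by (simp add: norm_minus_commute)
        finally have 2: "norm (G (x c) - G (x \<tau>) - G' (x \<tau>) (x c - x \<tau>)) \<le> e1 * integral {c..\<tau>} ?n" .
        have ik: "integral k g = x d' - x c"
          unfolding k using o by (intro integral_unique incr) auto
        have 3: "norm (G' (x \<tau>) (measure lborel k *\<^sub>R g \<tau> - integral k g))
               \<le> K * norm (measure lborel k *\<^sub>R g \<tau> - integral k g)"
          using K(2) B o by auto
        \<comment> \<open>The increment is linearized at the tag, which lies inside the interval, so it is split there into two.\<close>
        have eq: "measure lborel k *\<^sub>R G' (x \<tau>) (g \<tau>) - (G (x (Sup k)) - G (x (Inf k)))
          = G' (x \<tau>) (measure lborel k *\<^sub>R g \<tau> - integral k g)
            - (G (x d') - G (x \<tau>) - G' (x \<tau>) (x d' - x \<tau>))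
            + (G (x c) - G (x \<tau>) - G' (x \<tau>) (x c - x \<tau>))"
          unfolding r ik by (simp add: linear_diff[OF lin] linear_scale[OF lin])
        have tri: "norm (u - v + w) \<le> norm u + norm v + norm w" for u v w :: 'b
          using norm_triangle_ineq[of "u - v" w] norm_triangle_ineq4[of u v] by linarith
        have "e1 * integral k ?n = e1 * integral {c..\<tau>} ?n + e1 * integral {\<tau>..d'} ?n"
          using split by (simp flip: distrib_left)
        then show ?thesis
          unfolding eq using 1 2 3 by (intro order_trans[OF tri]) linarith
      qed
      have "(\<Sum>(\<tau>,k)\<in>p. measure lborel k *\<^sub>R G' (x \<tau>) (g \<tau>)) - (G (x b) - G (x a))
        = (\<Sum>(\<tau>,k)\<in>p. measure lborel k *\<^sub>R G' (x \<tau>) (g \<tau>) - (G (x (Sup k)) - G (x (Inf k))))"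
        using additive_tagged_division_1[OF ab p, of "\<lambda>\<tau>. G (x \<tau>)"]
        by (simp add: sum_subtractf case_prod_unfold)
      also have "norm \<dots> \<le> (\<Sum>(\<tau>,k)\<in>p. K * norm (measure lborel k *\<^sub>R g \<tau> - integral k g)
                         + e1 * integral k (\<lambda>\<tau>. norm (g \<tau>)))"
        unfolding case_prod_unfold by (rule sum_norm_le) (use loc in force)
      also have "\<dots> = K * (\<Sum>(\<tau>,k)\<in>p. norm (measure lborel k *\<^sub>R g \<tau> - integral k g)) + e1 * M"
      proof -
        have "M = (\<Sum>(\<tau>,k)\<in>p. integral k (\<lambda>\<tau>. norm (g \<tau>)))"
          unfolding M_def using integral_combine_tagged_division_topdown[of "\<lambda>\<tau>. norm (g \<tau>)" a b p] gn p
          by (simp add: case_prod_unfold)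
        then show ?thesis by (simp add: sum.distrib sum_distrib_left case_prod_unfold)
      qed
      also have "\<dots> \<le> K * e2 + e1 * M"
      proof -
        have "p tagged_partial_division_of (cbox a b)" using p unfolding box_real tagged_division_of_def by blast
        moreover have "\<gamma> fine p" using fine by (auto simp: fine_def)
        ultimately have "(\<Sum>(\<tau>,k)\<in>p. norm (measure lborel k *\<^sub>R g \<tau> - integral k g)) < e2" by (rule \<gamma>(2))
        then show ?thesis using K(1) by simp
      qed
      also have "\<dots> < e / 2 + e / 2"
        by (rule add_less_le_mono) (use K(1) M e in \<open>simp_all add: e1_def e2_def divide_simps\<close>)
      finally show ?thesis by simp
    qed
    show "\<exists>\<gamma>. gauge \<gamma> \<and> (\<forall>\<D>. \<D> tagged_division_of {a..b} \<and> \<gamma> fine \<D> \<longrightarrow>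
           norm ((\<Sum>(\<tau>,k)\<in>\<D>. measure lborel k *\<^sub>R G' (x \<tau>) (g \<tau>)) - (G (x b) - G (x a))) < e)"
      using gauge est by (intro exI[of _ "\<lambda>\<tau>. \<gamma> \<tau> \<inter> ball \<tau> \<eta>"] conjI allI impI) auto
  qed
qed

section \<open>Linear differential equations\<close>

text \<open>Picard iteration in the rescaled unknown \<open>exp (- 2 M \<tau>) z \<tau>\<close>: the exponential weight makes the integral operator a
contraction with constant 1/2 on the whole interval, however long it is.\<close>

lemma lipschitz_ode_solution:
  fixes F :: "real \<Rightarrow> 'a::euclidean_space \<Rightarrow> 'a"
  assumes T: "0 \<le> T"
    and contF: "\<And>\<phi>. continuous_on {0..T} \<phi> \<Longrightarrow> continuous_on {0..T} (\<lambda>\<tau>. F \<tau> (\<phi> \<tau>))"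
    and lip: "\<And>\<tau> v w. \<tau> \<in> {0..T} \<Longrightarrow> norm (F \<tau> v - F \<tau> w) \<le> L * norm (v - w)"
  obtains z where "z 0 = z0"
    and "\<And>\<tau>. \<tau> \<in> {0..T} \<Longrightarrow> (z has_vector_derivative F \<tau> (z \<tau>)) (at \<tau> within {0..T})"
proof -
  define M where "M = max L 1"
  have M: "M > 0" by (auto simp: M_def)
  have lipM: "norm (F \<tau> v - F \<tau> w) \<le> M * norm (v - w)" if "\<tau> \<in> {0..T}" for \<tau> v w
    using lip[OF that, of v w] mult_right_mono[of L M "norm (v - w)"] by (simp add: M_def)
  \<comment> \<open>In terms of the unknown \<open>\<phi> \<tau> = exp (- 2 M \<tau>) z \<tau>\<close>, the integral equation for \<open>z\<close> reads \<open>\<phi> = S \<phi>\<close>; clamping the time extends \<open>S \<phi>\<close> to a bounded continuous function on the line.\<close>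
  define I where "I = (\<lambda>\<phi> \<tau>. z0 + integral {0..\<tau>} (\<lambda>\<sigma>. F \<sigma> (exp (2 * M * \<sigma>) *\<^sub>R \<phi> \<sigma>)))"
  define S where "S = (\<lambda>\<phi> \<tau>. exp (- (2 * M * \<tau>)) *\<^sub>R I \<phi> \<tau>)"
  have cF: "continuous_on {0..T} (\<lambda>\<sigma>. F \<sigma> (exp (2 * M * \<sigma>) *\<^sub>R apply_bcontfun \<phi> \<sigma>))" for \<phi> :: "real \<Rightarrow>\<^sub>C 'a"
    by (intro contF continuous_intros continuous_on_apply_bcontfun)
  have "continuous_on {0..T} (S (apply_bcontfun \<phi>))" for \<phi>
    unfolding S_def I_def
    by (intro continuous_intros indefinite_integral_continuous_1 integrable_continuous_real cF)
  then have "\<exists>g::real \<Rightarrow>\<^sub>C 'a. \<forall>\<tau>. g \<tau> = S (apply_bcontfun \<phi>) (clamp 0 T \<tau>)" for \<phi>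
    using continuous_on_cbox_bcontfunE[of 0 T "S (apply_bcontfun \<phi>)"] by (metis box_real(2))
  then obtain N :: "(real \<Rightarrow>\<^sub>C 'a) \<Rightarrow> (real \<Rightarrow>\<^sub>C 'a)"
    where N: "\<And>\<phi> \<tau>. N \<phi> \<tau> = S (apply_bcontfun \<phi>) (clamp 0 T \<tau>)" by metis
  have clamp: "clamp 0 T \<tau> \<in> {0..T}" for \<tau> :: real
    using clamp_in_interval[of 0 T \<tau>] T by simp
  have contr: "dist (N \<phi>) (N \<psi>) \<le> 1/2 * dist \<phi> \<psi>" for \<phi> \<psi>
  proof (rule dist_bound)
    fix \<tau>' :: real
    define \<tau> where "\<tau> = clamp 0 T \<tau>'"
    have \<tau>: "\<tau> \<in> {0..T}" unfolding \<tau>_def by (rule clamp)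
    define D where "D = dist \<phi> \<psi>"
    have int: "(\<lambda>\<sigma>. F \<sigma> (exp (2 * M * \<sigma>) *\<^sub>R apply_bcontfun \<phi> \<sigma>)) integrable_on {0..\<tau>}" for \<phi>
      by (rule integrable_continuous_real, rule continuous_on_subset[OF cF]) (use \<tau> in auto)
    have ex: "((\<lambda>\<sigma>. M * D * exp (2 * M * \<sigma>)) has_integral
                 (D/2 * exp (2 * M * \<tau>) - D/2 * exp (2 * M * 0))) {0..\<tau>}"
      by (rule fundamental_theorem_of_calculus)
         (use \<tau> M in \<open>auto intro!: derivative_eq_intros simp flip: has_real_derivative_iff_has_vector_derivative\<close>)
    have "norm (I \<phi> \<tau> - I \<psi> \<tau>)
        = norm (integral {0..\<tau>} (\<lambda>\<sigma>. F \<sigma> (exp (2 * M * \<sigma>) *\<^sub>R apply_bcontfun \<phi> \<sigma>)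
                              - F \<sigma> (exp (2 * M * \<sigma>) *\<^sub>R apply_bcontfun \<psi> \<sigma>)))"
      unfolding I_def by (simp add: integral_diff[OF int int])
    also have "\<dots> \<le> integral {0..\<tau>} (\<lambda>\<sigma>. M * D * exp (2 * M * \<sigma>))"
    proof (rule integral_norm_bound_integral)
      show "(\<lambda>\<sigma>. M * D * exp (2 * M * \<sigma>)) integrable_on {0..\<tau>}" using ex by blast
      fix \<sigma> assume s: "\<sigma> \<in> {0..\<tau>}"
      have "norm (F \<sigma> (exp (2 * M * \<sigma>) *\<^sub>R apply_bcontfun \<phi> \<sigma>)
               - F \<sigma> (exp (2 * M * \<sigma>) *\<^sub>R apply_bcontfun \<psi> \<sigma>))
          \<le> M * norm (exp (2 * M * \<sigma>) *\<^sub>R (apply_bcontfun \<phi> \<sigma> - apply_bcontfun \<psi> \<sigma>))"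
        using lipM[of \<sigma>] s \<tau> by (simp add: scaleR_diff_right)
      also have "\<dots> = M * exp (2 * M * \<sigma>) * dist (apply_bcontfun \<phi> \<sigma>) (apply_bcontfun \<psi> \<sigma>)"
        by (simp add: dist_norm)
      also have "\<dots> \<le> M * exp (2 * M * \<sigma>) * D"
        unfolding D_def using M by (intro mult_left_mono dist_bounded) auto
      finally show "norm (F \<sigma> (exp (2 * M * \<sigma>) *\<^sub>R apply_bcontfun \<phi> \<sigma>)
               - F \<sigma> (exp (2 * M * \<sigma>) *\<^sub>R apply_bcontfun \<psi> \<sigma>)) \<le> M * D * exp (2 * M * \<sigma>)"
        by (simp add: mult_ac)
    qed (intro integrable_diff int)
    also have "\<dots> = D/2 * exp (2 * M * \<tau>) - D/2" using integral_unique[OF ex] by simp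
    also have "\<dots> \<le> D/2 * exp (2 * M * \<tau>)" by (simp add: D_def)
    finally have b: "norm (I \<phi> \<tau> - I \<psi> \<tau>) \<le> D/2 * exp (2 * M * \<tau>)" .
    have "dist (N \<phi> \<tau>') (N \<psi> \<tau>') = exp (- (2 * M * \<tau>)) * norm (I \<phi> \<tau> - I \<psi> \<tau>)"
      unfolding N S_def dist_norm \<tau>_def[symmetric] by (simp flip: scaleR_diff_right)
    also have "\<dots> \<le> exp (- (2 * M * \<tau>)) * (D/2 * exp (2 * M * \<tau>))"
      using b by (intro mult_left_mono) auto
    also have "\<dots> = D / 2" by (simp add: exp_minus)
    finally show "dist (N \<phi> \<tau>') (N \<psi> \<tau>') \<le> 1/2 * dist \<phi> \<psi>" by (simp add: D_def)
  qed
  have "\<exists>!\<phi>. N \<phi> = \<phi>" by (rule banach_fix_type[of "1/2"]) (use contr in auto)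
  then obtain \<phi> where \<phi>: "N \<phi> = \<phi>" by blast
  define z where "z = (\<lambda>\<tau>. exp (2 * M * \<tau>) *\<^sub>R apply_bcontfun \<phi> \<tau>)"
  have fix_eq: "apply_bcontfun \<phi> \<tau> = S (apply_bcontfun \<phi>) \<tau>" if "\<tau> \<in> {0..T}" for \<tau>
    using N[of \<phi> \<tau>] that \<phi> clamp_cancel_cbox[of \<tau> 0 T] by simp
  have z: "z \<tau> = z0 + integral {0..\<tau>} (\<lambda>\<sigma>. F \<sigma> (z \<sigma>))" if "\<tau> \<in> {0..T}" for \<tau>
    using fix_eq[OF that] by (simp add: z_def S_def I_def exp_minus)
  show thesis
  proof (rule that)
    show "z 0 = z0" using z[of 0] T by simp
    fix \<tau> assume \<tau>: "\<tau> \<in> {0..T}"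
    have "((\<lambda>\<tau>. integral {0..\<tau>} (\<lambda>\<sigma>. F \<sigma> (z \<sigma>))) has_vector_derivative F \<tau> (z \<tau>)) (at \<tau> within {0..T})"
      by (rule integral_has_vector_derivative[OF _ \<tau>]) (use cF[of \<phi>] in \<open>simp add: z_def\<close>)
    then have "((\<lambda>\<tau>. z0 + integral {0..\<tau>} (\<lambda>\<sigma>. F \<sigma> (z \<sigma>))) has_vector_derivative F \<tau> (z \<tau>)) (at \<tau> within {0..T})"
      by (auto intro!: derivative_eq_intros)
    then show "(z has_vector_derivative F \<tau> (z \<tau>)) (at \<tau> within {0..T})"
      by (rule has_vector_derivative_transform[OF \<tau>, rotated]) (use z in auto)
  qed
qed

lemma lipschitz_ode_terminal_value:
  fixes F :: "real \<Rightarrow> 'a::euclidean_space \<Rightarrow> 'a"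
  assumes T: "0 \<le> T"
    and contF: "\<And>\<phi>. continuous_on {0..T} \<phi> \<Longrightarrow> continuous_on {0..T} (\<lambda>\<tau>. F \<tau> (\<phi> \<tau>))"
    and lip: "\<And>\<tau> v w. \<tau> \<in> {0..T} \<Longrightarrow> norm (F \<tau> v - F \<tau> w) \<le> L * norm (v - w)"
  obtains z where "z T = zT"
    and "\<And>\<tau>. \<tau> \<in> {0..T} \<Longrightarrow> (z has_vector_derivative F \<tau> (z \<tau>)) (at \<tau> within {0..T})"
proof -
  have img: "(\<lambda>\<tau>. T - \<tau>) ` {0..T} = {0..T}"
    by (force simp: image_iff intro: bexI[of _ "T - x" for x])
  obtain \<zeta> where \<zeta>0: "\<zeta> 0 = zT"
    and \<zeta>: "\<And>\<sigma>. \<sigma> \<in> {0..T} \<Longrightarrow> (\<zeta> has_vector_derivative - F (T - \<sigma>) (\<zeta> \<sigma>)) (at \<sigma> within {0..T})"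
  proof (rule lipschitz_ode_solution[OF T, where F = "\<lambda>\<sigma> v. - F (T - \<sigma>) v" and L = L])
    fix \<phi> :: "real \<Rightarrow> 'a" assume c: "continuous_on {0..T} \<phi>"
    have "continuous_on {0..T} (\<lambda>\<tau>. \<phi> (T - \<tau>))"
      by (rule continuous_on_compose2[OF c]) (auto intro: continuous_intros)
    then have "continuous_on {0..T} (\<lambda>\<tau>. F \<tau> (\<phi> (T - \<tau>)))" by (rule contF)
    then have "continuous_on {0..T} (\<lambda>\<sigma>. F (T - \<sigma>) (\<phi> (T - (T - \<sigma>))))"
      by (rule continuous_on_compose2) (auto intro: continuous_intros)
    then show "continuous_on {0..T} (\<lambda>\<sigma>. - F (T - \<sigma>) (\<phi> \<sigma>))" by (simp add: continuous_on_minus)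
  next
    fix \<tau> v w assume "\<tau> \<in> {0..T}"
    then show "norm (- F (T - \<tau>) v - - F (T - \<tau>) w) \<le> L * norm (v - w)"
      using lip[of "T - \<tau>" v w] by (simp add: norm_minus_commute)
  qed blast
  show thesis
  proof (rule that[of "\<lambda>\<tau>. \<zeta> (T - \<tau>)"])
    fix \<tau> assume \<tau>: "\<tau> \<in> {0..T}"
    have "((\<lambda>\<tau>. T - \<tau>) has_vector_derivative - 1) (at \<tau> within {0..T})"
      by (auto intro!: derivative_eq_intros)
    moreover have "(\<zeta> has_vector_derivative - F \<tau> (\<zeta> (T - \<tau>))) (at (T - \<tau>) within (\<lambda>\<tau>. T - \<tau>) ` {0..T})"
      unfolding img using \<zeta>[of "T - \<tau>"] \<tau> by simp
    ultimately show "((\<lambda>\<tau>. \<zeta> (T - \<tau>)) has_vector_derivative F \<tau> (\<zeta> (T - \<tau>))) (at \<tau> within {0..T})"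
      using vector_diff_chain_within[of "\<lambda>\<tau>. T - \<tau>" "- 1" \<tau> "{0..T}" \<zeta> "- F \<tau> (\<zeta> (T - \<tau>))"]
      by (simp add: o_def)
  qed (simp add: \<zeta>0)
qed

text \<open>Gronwall's inequality in differential form: \<open>exp (- 2 K \<tau>) * (norm (D \<tau>))\<^sup>2\<close> is nonincreasing.\<close>

lemma zero_of_linear_growth:
  fixes D :: "real \<Rightarrow> 'a::real_inner"
  assumes der: "\<And>\<tau>. \<tau> \<in> {0..T} \<Longrightarrow> (D has_vector_derivative D' \<tau>) (at \<tau> within {0..T})"
    and bound: "\<And>\<tau>. \<tau> \<in> {0..T} \<Longrightarrow> norm (D' \<tau>) \<le> K * norm (D \<tau>)"
    and D0: "D 0 = 0" and \<tau>: "\<tau> \<in> {0..T}"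
  shows "D \<tau> = 0"
proof -
  define E where "E = (\<lambda>\<tau>. exp (- 2 * K * \<tau>) * (D \<tau> \<bullet> D \<tau>))"
  have derE: "(E has_real_derivative exp (- 2 * K * \<sigma>) * (2 * (D \<sigma> \<bullet> D' \<sigma>) - 2 * K * (D \<sigma> \<bullet> D \<sigma>)))
                 (at \<sigma> within {0..T})" if "\<sigma> \<in> {0..T}" for \<sigma>
  proof -
    have "((\<lambda>\<tau>. D \<tau> \<bullet> D \<tau>) has_real_derivative 2 * (D \<sigma> \<bullet> D' \<sigma>)) (at \<sigma> within {0..T})"
      unfolding has_field_derivative_def
      by (rule has_derivative_eq_rhs[OF has_derivative_inner[OF der[OF that, unfolded has_vector_derivative_def]
          der[OF that, unfolded has_vector_derivative_def]]])
         (auto simp: fun_eq_iff inner_commute algebra_simps)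
    then show ?thesis
      unfolding E_def by (auto intro!: derivative_eq_intros simp: algebra_simps)
  qed
  have "E 0 \<ge> E \<tau>"
  proof (rule DERIV_nonpos_imp_decreasing_open[where f = E and a = 0 and b = \<tau>])
    show "0 \<le> \<tau>" using \<tau> by simp
    show "continuous_on {0..\<tau>} E"
      by (rule continuous_on_subset[OF DERIV_continuous_on[OF derE]]) (use \<tau> in auto)
    fix \<sigma> assume \<sigma>: "0 < \<sigma>" "\<sigma> < \<tau>"
    then have in_T: "\<sigma> \<in> {0..T}" using \<tau> by auto
    have "at \<sigma> within {0..T} = at \<sigma>" using \<sigma> \<tau> by (intro at_within_interior) auto
    moreover have "D \<sigma> \<bullet> D' \<sigma> \<le> K * (D \<sigma> \<bullet> D \<sigma>)"
    proof -
      have "D \<sigma> \<bullet> D' \<sigma> \<le> norm (D \<sigma>) * norm (D' \<sigma>)" by (rule norm_cauchy_schwarz)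
      also have "\<dots> \<le> norm (D \<sigma>) * (K * norm (D \<sigma>))"
        using bound[OF in_T] by (intro mult_left_mono) auto
      finally show ?thesis by (simp add: dot_square_norm power2_eq_square mult_ac)
    qed
    then have "exp (- 2 * K * \<sigma>) * (2 * (D \<sigma> \<bullet> D' \<sigma>) - 2 * K * (D \<sigma> \<bullet> D \<sigma>)) \<le> 0"
      by (intro mult_nonneg_nonpos) auto
    ultimately show "\<exists>y. (E has_real_derivative y) (at \<sigma>) \<and> y \<le> 0"
      using derE[OF in_T] by metis
  qed
  then have "exp (- 2 * K * \<tau>) * (D \<tau> \<bullet> D \<tau>) \<le> 0" using D0 by (simp add: E_def)
  then have "D \<tau> \<bullet> D \<tau> \<le> 0" by (simp add: mult_le_0_iff)
  then show ?thesis by (simp add: dot_square_norm)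
qed

section \<open>Positive definite matrices and the largest eigenvalue\<close>

lemma bounded_bilinear_matrix_vector: "bounded_bilinear (\<lambda>(A :: real^'n^'m) v. A *v v)"
  unfolding bilinear_conv_bounded_bilinear[symmetric] bilinear_def linear_iff
  by (simp add: matrix_vector_right_distrib matrix_vector_mult_add_rdistrib
      scaleR_matrix_vector_assoc matrix_vector_mult_scaleR)

lemma bounded_bilinear_matrix_matrix: "bounded_bilinear (\<lambda>(A :: real^'n^'m) (B :: real^'k^'n). A ** B)"
  unfolding bilinear_conv_bounded_bilinear[symmetric] bilinear_def linear_iff
  by (simp add: vec_eq_iff matrix_matrix_mult_def sum.distrib distrib_left distrib_right
      sum_distrib_left mult.assoc mult.left_commute)

lemmas continuous_on_matrix_vector [continuous_intros] = bounded_bilinear.continuous_on[OF bounded_bilinear_matrix_vector]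

lemmas continuous_on_matrix_matrix [continuous_intros] = bounded_bilinear.continuous_on[OF bounded_bilinear_matrix_matrix]

lemma bounded_linear_transpose: "bounded_linear (transpose :: real^'n^'m \<Rightarrow> real^'m^'n)"
  by (intro linear_conv_bounded_linear[THEN iffD1] linearI) (auto simp: vec_eq_iff transpose_def)

lemma transpose_matrix_vector_inner: "(transpose A *v x) \<bullet> y = x \<bullet> ((A :: real^'n^'m) *v y)"
  by (metis dot_lmul_matrix transpose_matrix_vector)

lemma symmetric_inner:
  assumes "transpose A = (A :: real^'n^'n)" shows "(A *v x) \<bullet> y = x \<bullet> (A *v y)"
  using transpose_matrix_vector_inner[of A x y] assms by simp

lemma matrix_inv_works:
  fixes A :: "real^'n^'n" assumes "invertible A"
  shows "A ** matrix_inv A = mat 1" "matrix_inv A ** A = mat 1"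
  using someI_ex[OF assms[unfolded invertible_def]] by (auto simp: matrix_inv_def)

lemma matrix_inv_cancel:
  fixes A :: "real^'n^'n" assumes "invertible A"
  shows "A *v (matrix_inv A *v x) = x" "matrix_inv A *v (A *v x) = x"
  using matrix_inv_works[OF assms] by (simp_all add: matrix_vector_mul_assoc)

lemma definite_invertible:
  fixes A :: "real^'n^'n" assumes "\<And>v. v \<noteq> 0 \<Longrightarrow> v \<bullet> (A *v v) > 0"
  shows "invertible A"
  unfolding invertible_left_inverse matrix_left_invertible_ker
proof (intro allI impI)
  fix v assume "A *v v = 0"
  then show "v = 0" using assms[of v] by auto
qed

lemma pos_def_invertible: "pos_def A \<Longrightarrow> invertible A"
  by (rule definite_invertible) (auto simp: pos_def_def)

lemma pos_def_nonneg: "pos_def A \<Longrightarrow> v \<bullet> (A *v v) \<ge> 0"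
  by (cases "v = 0") (auto simp: pos_def_def intro: less_imp_le)

lemma pos_def_matrix_inv:
  assumes A: "pos_def A" shows "pos_def (matrix_inv A)"
proof -
  note c = matrix_inv_cancel[OF pos_def_invertible[OF A]]
  have sym: "transpose A = A" using A by (simp add: pos_def_def)
  have swap: "(matrix_inv A *v x) \<bullet> y = x \<bullet> (matrix_inv A *v y)" for x y
    using symmetric_inner[OF sym, of "matrix_inv A *v x" "matrix_inv A *v y"] c by simp
  have "transpose (matrix_inv A) *v x = matrix_inv A *v x" for x
    by (rule vector_eq_rdot[THEN iffD1]) (simp add: transpose_matrix_vector_inner swap del: transpose_matrix_vector)
  then have "transpose (matrix_inv A) = matrix_inv A" by (simp add: matrix_eq)
  moreover have "v \<bullet> (matrix_inv A *v v) > 0" if "v \<noteq> 0" for v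
  proof -
    have "matrix_inv A *v v \<noteq> 0" using c(1)[of v] that by auto
    then have "(matrix_inv A *v v) \<bullet> (A *v (matrix_inv A *v v)) > 0"
      using A by (auto simp: pos_def_def)
    then show ?thesis using c by (simp add: inner_commute)
  qed
  ultimately show ?thesis by (simp add: pos_def_def)
qed

text \<open>The quadratic form is continuous and positive on the compact product of the parameter set with the unit
sphere, so it has a positive minimum there. Applied along a trajectory, this makes a control of finite cost square
integrable.\<close>

lemma uniformly_coercive:
  fixes A :: "'t::topological_space \<Rightarrow> real^'n^'n"
  assumes K: "compact K" and cont: "continuous_on K A"
    and pos: "\<And>\<tau> v. \<lbrakk>\<tau> \<in> K; v \<noteq> 0\<rbrakk> \<Longrightarrow> v \<bullet> (A \<tau> *v v) > 0"
  obtains k where "k > 0" and "\<And>\<tau> v. \<tau> \<in> K \<Longrightarrow> k * (norm v)\<^sup>2 \<le> v \<bullet> (A \<tau> *v v)"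
proof (cases "K = {}")
  case True then show thesis using that[of 1] by auto
next
  case False
  define q where "q = (\<lambda>p. snd p \<bullet> (A (fst p) *v snd p))"
  have ne: "K \<times> sphere (0 :: real^'n) 1 \<noteq> {}" using False by auto
  have "continuous_on (K \<times> sphere 0 1) (\<lambda>p. A (fst p))"
    by (rule continuous_on_compose2[OF cont continuous_on_fst[OF continuous_on_id]]) auto
  then have "continuous_on (K \<times> sphere 0 1) q"
    unfolding q_def by (intro continuous_intros)
  then obtain p where p: "p \<in> K \<times> sphere 0 1"
    and min: "\<And>p'. p' \<in> K \<times> sphere 0 1 \<Longrightarrow> q p \<le> q p'"
    using continuous_attains_inf[OF compact_Times[OF K compact_sphere] ne] by metis
  show thesis
  proof (rule that)
    have "snd p \<noteq> 0" using p by (auto simp: mem_Times_iff)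
    then show "q p > 0" using p pos[of "fst p" "snd p"] by (auto simp: q_def)
    fix \<tau> v assume \<tau>: "\<tau> \<in> K"
    show "q p * (norm v)\<^sup>2 \<le> v \<bullet> (A \<tau> *v v)"
    proof (cases "v = 0")
      case False
      define u where "u = (1 / norm v) *\<^sub>R v"
      have "q p \<le> u \<bullet> (A \<tau> *v u)"
        using min[of "(\<tau>, u)"] \<tau> False by (auto simp: q_def u_def)
      also have "\<dots> = (v \<bullet> (A \<tau> *v v)) / (norm v)\<^sup>2"
        by (simp add: u_def matrix_vector_mult_scaleR power2_eq_square)
      finally show ?thesis using False by (simp add: field_simps)
    qed simp
  qed
qed

lemma pos_def_coercive:
  assumes "pos_def A" obtains k where "k > 0" and "\<And>v. k * (norm v)\<^sup>2 \<le> v \<bullet> (A *v v)"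
  by (rule uniformly_coercive[of "{0::real}" "\<lambda>_. A"]) (use assms in \<open>auto simp: pos_def_def\<close>)

text \<open>A zero of a nonnegative form is a minimum of it, so the gradient vanishes: moving from \<open>v\<close> a short step in the direction
\<open>- (B *v v)\<close> would otherwise make the form negative.\<close>

lemma psd_kernel:
  fixes B :: "real^'n^'n"
  assumes sym: "transpose B = B" and psd: "\<And>v. v \<bullet> (B *v v) \<ge> 0" and v: "v \<bullet> (B *v v) = 0"
  shows "B *v v = 0"
proof -
  define w where "w = B *v v"
  define q where "q = w \<bullet> (B *v w)"
  have q: "q \<ge> 0" unfolding q_def by (rule psd)
  \<comment> \<open>The step length would be \<open>(w \<bullet> w) / q\<close> for a minimum along the line; adding 1 avoids a vanishing denominator.\<close>
  define s where "s = (w \<bullet> w) / (q + 1)"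
  have vw: "v \<bullet> (B *v w) = w \<bullet> w" using symmetric_inner[OF sym, of v w] by (simp add: w_def)
  have "0 \<le> (v - s *\<^sub>R w) \<bullet> (B *v (v - s *\<^sub>R w))" by (rule psd)
  also have "\<dots> = s * s * q - 2 * s * (w \<bullet> w)"
    using v vw by (simp add: q_def w_def[symmetric] matrix_vector_mult_diff_distrib
        matrix_vector_mult_scaleR inner_diff_left inner_diff_right algebra_simps)
  also have "s * s * q - 2 * s * (w \<bullet> w) = - (w \<bullet> w)\<^sup>2 * (q + 2) / (q + 1)\<^sup>2"
    using q by (simp add: s_def divide_simps) (simp add: power2_eq_square algebra_simps)
  finally have "(w \<bullet> w)\<^sup>2 * (q + 2) / (q + 1)\<^sup>2 \<le> 0" by simp
  then have "w \<bullet> w = 0" using q by (simp add: divide_le_0_iff mult_le_0_iff)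
  then show ?thesis by (simp add: w_def)
qed

lemma poly_charpoly: "poly (charpoly A) l = det (mat l - (A :: real^'n^'n))"
proof -
  have "poly ((mat [:0, 1:] - map_matrix (\<lambda>a. [:a:]) A) $ i $ j) l = (mat l - A) $ i $ j" for i j
    by (simp add: mat_def)
  then show ?thesis
    unfolding charpoly_def det_def poly_sum poly_mult poly_prod poly_of_int by simp
qed

text \<open>The maximum \<open>m\<close> of the form on the unit sphere is an eigenvalue: \<open>m I - A\<close> is nonnegative and its form vanishes at a
maximizer, which therefore lies in the kernel. The matrix \<open>(m + 1) I - A\<close> is definite, so that the characteristic
polynomial is not zero and its roots form a finite set, as the maximum in \<open>lambda_max\<close> requires.\<close>

lemma rayleigh_le_lambda_max:
  fixes A :: "real^'n^'n"
  assumes sym: "transpose A = A"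
  shows "v \<bullet> (A *v v) \<le> lambda_max A * (norm v)\<^sup>2"
proof -
  have ne: "sphere (0 :: real^'n) 1 \<noteq> {}" by simp
  have "continuous_on (sphere 0 1) (\<lambda>v. v \<bullet> (A *v v))" by (intro continuous_intros)
  from continuous_attains_sup[OF compact_sphere ne this]
  obtain v0 where v0: "norm v0 = 1"
    and max: "\<And>v. norm v = 1 \<Longrightarrow> v \<bullet> (A *v v) \<le> v0 \<bullet> (A *v v0)"
    unfolding Ball_def Bex_def mem_sphere_0 by blast
  define m where "m = v0 \<bullet> (A *v v0)"
  have le: "v \<bullet> (A *v v) \<le> m * (norm v)\<^sup>2" for v
  proof (cases "v = 0")
    case False
    have "((1 / norm v) *\<^sub>R v) \<bullet> (A *v ((1 / norm v) *\<^sub>R v)) \<le> m"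
      unfolding m_def by (rule max) (use False in simp)
    then show ?thesis
      using False by (simp add: matrix_vector_mult_scaleR power2_eq_square field_simps)
  qed simp
  have mat: "mat l *v v = l *\<^sub>R v" for l and v :: "real^'n"
  proof -
    have "mat l = l *\<^sub>R (mat 1 :: real^'n^'n)" by (simp add: vec_eq_iff mat_def)
    then show ?thesis by (metis scaleR_matrix_vector_assoc matrix_vector_mul_lid)
  qed
  have quad: "v \<bullet> ((mat l - A) *v v) = l * (norm v)\<^sup>2 - v \<bullet> (A *v v)" for l v
    by (simp add: matrix_vector_mult_diff_rdistrib mat inner_diff_right power2_norm_eq_inner)
  have "(mat m - A) *v v0 = 0"
  proof (rule psd_kernel)
    show "transpose (mat m - A) = mat m - A"
      using sym by (simp add: vec_eq_iff transpose_def mat_def)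
    show "v \<bullet> ((mat m - A) *v v) \<ge> 0" for v using le[of v] by (simp add: quad)
    show "v0 \<bullet> ((mat m - A) *v v0) = 0" by (simp add: quad v0 m_def)
  qed
  then have "\<not> invertible (mat m - A)"
    using v0 unfolding invertible_left_inverse matrix_left_invertible_ker by force
  then have root: "poly (charpoly A) m = 0" by (simp add: poly_charpoly invertible_det_nz)
  have "invertible (mat (m + 1) - A)"
  proof (rule definite_invertible)
    fix v :: "real^'n" assume "v \<noteq> 0"
    then have "(norm v)\<^sup>2 > 0" by simp
    then show "v \<bullet> ((mat (m + 1) - A) *v v) > 0" 
      unfolding quad distrib_right mult_1 using le[of v] by linarith
  qed
  then have "poly (charpoly A) (m + 1) \<noteq> 0" by (simp add: poly_charpoly invertible_det_nz)
  then have "charpoly A \<noteq> 0" by auto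
  then have "m \<le> lambda_max A"
    unfolding lambda_max_def using root poly_roots_finite by (intro Max_ge) auto
  then have "m * (norm v)\<^sup>2 \<le> lambda_max A * (norm v)\<^sup>2" by (intro mult_right_mono) auto
  then show ?thesis using le[of v] by simp
qed

text \<open>The Cauchy-Schwarz inequality for the inner product given by \<open>A\<close>, combined with the bound for the form itself.\<close>

lemma pos_def_inner_le:
  fixes A :: "real^'n^'n"
  assumes A: "pos_def A"
  shows "\<bar>a \<bullet> (A *v b)\<bar> \<le> lambda_max A * norm a * norm b"
proof (cases "b = 0")
  case False
  have sym: "transpose A = A" using A by (simp add: pos_def_def)
  define qa where "qa = a \<bullet> (A *v a)"
  define qb where "qb = b \<bullet> (A *v b)"
  define ab where "ab = a \<bullet> (A *v b)"
  have ba: "b \<bullet> (A *v a) = ab" using symmetric_inner[OF sym, of b a] by (simp add: ab_def inner_commute)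
  have qb: "qb > 0" unfolding qb_def using A False by (simp add: pos_def_def)
  have qa: "qa \<ge> 0" unfolding qa_def by (rule pos_def_nonneg[OF A])
  \<comment> \<open>This vector is \<open>qb\<close> times the component of \<open>a\<close> that is orthogonal to \<open>b\<close> with respect to \<open>A\<close>.\<close>
  have "0 \<le> (qb *\<^sub>R a - ab *\<^sub>R b) \<bullet> (A *v (qb *\<^sub>R a - ab *\<^sub>R b))" by (rule pos_def_nonneg[OF A])
  also have "\<dots> = qb * (qa * qb - ab\<^sup>2)"
    by (simp add: matrix_vector_mult_diff_distrib matrix_vector_mult_scaleR inner_diff_left
        inner_diff_right ba ab_def[symmetric] qa_def[symmetric] qb_def[symmetric])
       (simp add: power2_eq_square algebra_simps)
  finally have "ab\<^sup>2 \<le> qa * qb" using qb by (simp add: zero_le_mult_iff)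
  also have "\<dots> \<le> (lambda_max A * (norm a)\<^sup>2) * (lambda_max A * (norm b)\<^sup>2)"
    using rayleigh_le_lambda_max[OF sym, of a] rayleigh_le_lambda_max[OF sym, of b] qa qb
    by (intro mult_mono) (auto simp: qa_def qb_def)
  also have "\<dots> = (lambda_max A * norm a * norm b)\<^sup>2" by (simp add: power2_eq_square mult_ac)
  finally have le: "ab\<^sup>2 \<le> (lambda_max A * norm a * norm b)\<^sup>2" .
  \<comment> \<open>Passing from squares to absolute values uses that the bound is nonnegative.\<close>
  have "0 < lambda_max A * (norm b)\<^sup>2"
    using rayleigh_le_lambda_max[OF sym, of b] qb by (simp add: qb_def)
  then have "lambda_max A > 0" using False by (simp add: zero_less_mult_iff)
  then have "0 \<le> lambda_max A * norm a * norm b" by simp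
  then show ?thesis
    using le unfolding ab_def[symmetric] by (simp add: abs_le_square_iff[symmetric])
qed simp

section \<open>Square integrable signals\<close>

text \<open>Square integrability carries the measurability that the gauge integral of the squared norm alone would not give.\<close>

definition square_integrable_on :: "(real \<Rightarrow> 'a::euclidean_space) \<Rightarrow> real set \<Rightarrow> bool"
    (infixr "square'_integrable'_on" 46) where
  "u square_integrable_on S \<longleftrightarrow>
     u \<in> borel_measurable (lebesgue_on S) \<and> (\<lambda>\<tau>. (norm (u \<tau>))\<^sup>2) integrable_on S"

lemma integrable_on_dominated:
  fixes u :: "real \<Rightarrow> 'a::euclidean_space"
  assumes "u \<in> borel_measurable (lebesgue_on {a..b})" and "g integrable_on {a..b}"
    and "\<And>\<tau>. \<tau> \<in> {a..b} \<Longrightarrow> norm (u \<tau>) \<le> g \<tau>"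
  shows "u integrable_on {a..b}"
  by (rule measurable_bounded_by_integrable_imp_integrable[OF assms(1,2,3)]) auto

lemma square_integrable_dominated:
  fixes u :: "real \<Rightarrow> 'a::euclidean_space"
  assumes u: "u \<in> borel_measurable (lebesgue_on {a..b})" and g: "g integrable_on {a..b}"
    and le: "\<And>\<tau>. \<tau> \<in> {a..b} \<Longrightarrow> (norm (u \<tau>))\<^sup>2 \<le> g \<tau>"
  shows "u square_integrable_on {a..b}"
  unfolding square_integrable_on_def
proof (intro conjI u)
  have "(\<lambda>\<tau>. (norm (u \<tau>))\<^sup>2) \<in> borel_measurable (lebesgue_on {a..b})" using u by measurable
  then show "(\<lambda>\<tau>. (norm (u \<tau>))\<^sup>2) integrable_on {a..b}"
    by (rule integrable_on_dominated[OF _ g]) (use le in auto)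
qed

lemma continuous_square_integrable:
  fixes u :: "real \<Rightarrow> 'a::euclidean_space"
  assumes "continuous_on {a..b} u" shows "u square_integrable_on {a..b}"
proof (rule square_integrable_dominated)
  show "u \<in> borel_measurable (lebesgue_on {a..b})"
    using assms by (intro continuous_imp_measurable_on_sets_lebesgue) auto
  show "(\<lambda>\<tau>. (norm (u \<tau>))\<^sup>2) integrable_on {a..b}"
    by (intro integrable_continuous_real continuous_intros assms)
qed simp

lemma square_integrable_diff:
  fixes u v :: "real \<Rightarrow> 'a::euclidean_space"
  assumes u: "u square_integrable_on {a..b}" and v: "v square_integrable_on {a..b}"
  shows "(\<lambda>\<tau>. u \<tau> - v \<tau>) square_integrable_on {a..b}"
proof (rule square_integrable_dominated)
  show "(\<lambda>\<tau>. u \<tau> - v \<tau>) \<in> borel_measurable (lebesgue_on {a..b})"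
    using u v unfolding square_integrable_on_def by (intro borel_measurable_diff) auto
  show "(\<lambda>\<tau>. 2 * (norm (u \<tau>))\<^sup>2 + 2 * (norm (v \<tau>))\<^sup>2) integrable_on {a..b}"
    using u v unfolding square_integrable_on_def
    by (intro integrable_add integrable_on_mult_right) auto
  fix \<tau>
  have "(norm (u \<tau> - v \<tau>))\<^sup>2 \<le> (norm (u \<tau>) + norm (v \<tau>))\<^sup>2"
    by (intro power_mono norm_triangle_ineq4) auto
  also have "\<dots> \<le> 2 * (norm (u \<tau>))\<^sup>2 + 2 * (norm (v \<tau>))\<^sup>2"
    using sum_squares_bound[of "norm (u \<tau>)" "norm (v \<tau>)"] by (simp add: power2_sum)
  finally show "(norm (u \<tau> - v \<tau>))\<^sup>2 \<le> 2 * (norm (u \<tau>))\<^sup>2 + 2 * (norm (v \<tau>))\<^sup>2" .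
qed

lemma square_integrable_matrix:
  fixes A :: "real^'n^'m"
  assumes u: "u square_integrable_on {a..b}"
  shows "(\<lambda>\<tau>. A *v u \<tau>) square_integrable_on {a..b}"
proof -
  obtain K where K: "\<And>v. norm (A *v v) \<le> norm v * K"
    using bounded_linear.bounded[OF matrix_vector_mul_bounded_linear[of A]] by blast
  show ?thesis
  proof (rule square_integrable_dominated)
  show "(\<lambda>\<tau>. A *v u \<tau>) \<in> borel_measurable (lebesgue_on {a..b})"
    using u unfolding square_integrable_on_def
    by (intro borel_measurable_continuous_on[of "\<lambda>v. A *v v"] continuous_intros) auto
  show "(\<lambda>\<tau>. K\<^sup>2 * (norm (u \<tau>))\<^sup>2) integrable_on {a..b}"
    using u unfolding square_integrable_on_def by (intro integrable_on_mult_right) auto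
  fix \<tau> show "(norm (A *v u \<tau>))\<^sup>2 \<le> K\<^sup>2 * (norm (u \<tau>))\<^sup>2"
    using power_mono[OF K[of "u \<tau>"], of 2] by (simp add: power_mult_distrib mult.commute)
  qed
qed

lemma square_integrable_quadratic_form:
  fixes A :: "real^'n^'n"
  assumes u: "u square_integrable_on {a..b}"
  shows "(\<lambda>\<tau>. u \<tau> \<bullet> (A *v u \<tau>)) integrable_on {a..b}"
proof (rule integrable_on_dominated)
  note Au = square_integrable_matrix[OF u, of A]
  show "(\<lambda>\<tau>. u \<tau> \<bullet> (A *v u \<tau>)) \<in> borel_measurable (lebesgue_on {a..b})"
    using u Au unfolding square_integrable_on_def by (intro borel_measurable_inner) auto
  show "(\<lambda>\<tau>. (norm (u \<tau>))\<^sup>2 + (norm (A *v u \<tau>))\<^sup>2) integrable_on {a..b}"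
    using u Au unfolding square_integrable_on_def by (intro integrable_add) auto
  fix \<tau>
  have "norm (u \<tau>) * norm (A *v u \<tau>) \<ge> 0" by simp
  then show "norm (u \<tau> \<bullet> (A *v u \<tau>)) \<le> (norm (u \<tau>))\<^sup>2 + (norm (A *v u \<tau>))\<^sup>2"
    using Cauchy_Schwarz_ineq2[of "u \<tau>" "A *v u \<tau>"]
      sum_squares_bound[of "norm (u \<tau>)" "norm (A *v u \<tau>)"] unfolding real_norm_def by linarith
qed

lemma square_integrable_absolutely:
  fixes u :: "real \<Rightarrow> 'a::euclidean_space"
  assumes u: "u square_integrable_on {a..b}"
  shows "u absolutely_integrable_on {a..b}"
proof -
  have g: "(\<lambda>\<tau>. 1 + (norm (u \<tau>))\<^sup>2) integrable_on {a..b}"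
    using u unfolding square_integrable_on_def by (intro integrable_add) auto
  have le: "norm (u \<tau>) \<le> 1 + (norm (u \<tau>))\<^sup>2" for \<tau>
    using sum_squares_bound[of "norm (u \<tau>)" 1] norm_ge_zero[of "u \<tau>"]
    unfolding one_power2 mult_1_right by linarith
  have "u integrable_on {a..b}"
    using u le unfolding square_integrable_on_def by (intro integrable_on_dominated[OF _ g]) auto
  then show ?thesis by (rule absolutely_integrable_integrable_bound[OF le _ g])
qed

lemma square_integrable_subset:
  assumes "u square_integrable_on {a..b}" and "{c..d} \<subseteq> {a..b}"
  shows "u square_integrable_on {c..d}"
  using assms unfolding square_integrable_on_def
  by (auto intro: measurable_restrict_mono integrable_subinterval_real)

text \<open>As a function of the point \<open>v\<close>, the distance to the farthest value of \<open>h\<close> is 1-Lipschitz. This makes the supremum over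
the uncountably many states in the bound \<open>\<delta>\<close> a measurable function of time.\<close>

lemma continuous_on_sup_distance:
  fixes h :: "'a \<Rightarrow> 'b::real_normed_vector"
  assumes bdd: "bounded (range h)"
  shows "continuous_on UNIV (\<lambda>v. SUP x. norm (v - h x))"
proof -
  obtain B where B: "\<And>x. norm (h x) \<le> B" using bdd by (auto simp: bounded_iff)
  have above: "bdd_above (range (\<lambda>x. norm (v - h x)))" for v
    using B norm_triangle_ineq4[of v] by (intro bdd_aboveI2[of _ _ "norm v + B"]) (meson add_left_mono order_trans)
  have "(SUP x. norm (v - h x)) \<le> (SUP x. norm (w - h x)) + dist v w" for v w
  proof (rule cSUP_least)
    fix x
    have "norm (v - h x) \<le> norm (w - h x) + dist v w"
      using norm_triangle_ineq[of "w - h x" "v - w"] by (simp add: dist_norm)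
    also have "norm (w - h x) \<le> (SUP x. norm (w - h x))" by (rule cSUP_upper[OF UNIV_I above])
    finally show "norm (v - h x) \<le> (SUP x. norm (w - h x)) + dist v w" by simp
  qed simp
  note le = this
  have "dist (SUP x. norm (v - h x)) (SUP x. norm (w - h x)) \<le> dist v w" for v w
    using le[of v w] le[of w v] by (simp add: dist_real_def abs_le_iff dist_commute)
  then have "1-lipschitz_on UNIV (\<lambda>v. SUP x. norm (v - h x))" by (intro lipschitz_onI) auto
  then show ?thesis by (rule lipschitz_on_continuous_on)
qed

lemma sup_distance_integrable:
  fixes h :: "'a \<Rightarrow> 'b::euclidean_space" and y :: "real \<Rightarrow> 'b"
  assumes bdd: "bounded (range h)" and y: "y square_integrable_on {a..b}"
  shows "(\<lambda>t. SUP x. norm (y t - h x)) integrable_on {a..b}"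
proof -
  obtain B where B: "\<And>x. norm (h x) \<le> B" using bdd by (auto simp: bounded_iff)
  have le: "norm (w - h x) \<le> norm w + B" for w x
    using norm_triangle_ineq4[of w "h x"] B[of x] by linarith
  have bound: "norm (SUP x. norm (w - h x)) \<le> norm w + B" for w
  proof -
    have "bdd_above (range (\<lambda>x. norm (w - h x)))" using le by (intro bdd_aboveI2)
    then have "norm (w - h undefined) \<le> (SUP x. norm (w - h x))" by (rule cSUP_upper[OF UNIV_I])
    then have "0 \<le> (SUP x. norm (w - h x))" using norm_ge_zero order_trans by blast
    moreover have "(SUP x. norm (w - h x)) \<le> norm w + B" by (intro cSUP_least le) simp
    ultimately show ?thesis by simp
  qed
  show ?thesis
  proof (rule integrable_on_dominated)
    show "(\<lambda>t. SUP x. norm (y t - h x)) \<in> borel_measurable (lebesgue_on {a..b})"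
      using y unfolding square_integrable_on_def
      by (intro borel_measurable_continuous_on[OF continuous_on_sup_distance[OF bdd]]) auto
    have "(\<lambda>t. norm (y t)) integrable_on {a..b}"
      using square_integrable_absolutely[OF y] by (simp add: absolutely_integrable_on_def)
    then show "(\<lambda>t. norm (y t) + B) integrable_on {a..b}" by (intro integrable_add) auto
  qed (rule bound)
qed

section \<open>The linear-quadratic problem\<close>

text \<open>The antisymmetric part of \<open>P\<close> starts at 0 and satisfies a linear homogeneous equation: the difference of the
quadratic terms is \<open>P R P - P\<^sup>T R P\<^sup>T = D R P + P\<^sup>T R D\<close> for \<open>D = P - P\<^sup>T\<close>.\<close>

lemma riccati_symmetric:
  fixes P :: "real \<Rightarrow> real^'n^'n"
  assumes der: "\<And>t. t \<in> {0..T} \<Longrightarrow> (P has_vector_derivative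
           - (transpose \<Lambda> ** P t + P t ** \<Lambda> + P t ** R ** P t - S)) (at t within {0..T})"
    and R: "transpose R = R" and S: "transpose S = S" and P0: "transpose (P 0) = P 0"
    and t: "t \<in> {0..T}"
  shows "transpose (P t) = P t"
proof -
  let ?P' = "\<lambda>t. - (transpose \<Lambda> ** P t + P t ** \<Lambda> + P t ** R ** P t - S)"
  define D where "D = (\<lambda>t. P t - transpose (P t))"
  define D' where "D' = (\<lambda>t. ?P' t - transpose (?P' t))"
  have tadd: "transpose (A + B) = transpose A + transpose B"
    and tdiff: "transpose (A - B) = transpose A - transpose B"
    and tneg: "transpose (- A) = - transpose A" for A B :: "real^'n^'n"
    by (auto simp: vec_eq_iff transpose_def)
  interpret mm: bounded_bilinear "\<lambda>(A :: real^'n^'n) (B :: real^'n^'n). A ** B"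
    by (rule bounded_bilinear_matrix_matrix)
  have derD: "(D has_vector_derivative D' t) (at t within {0..T})" if "t \<in> {0..T}" for t
    unfolding D_def D'_def
    by (intro has_vector_derivative_diff der that bounded_linear.has_vector_derivative[OF bounded_linear_transpose])
  have D'_eq: "D' t = - (transpose \<Lambda> ** D t + D t ** \<Lambda> + D t ** (R ** P t) + (transpose (P t) ** R) ** D t)" for t
  proof -
    have rearrange: "- (a + b + c - S) - - (d + e + f - S) = - ((a - e) + (b - d) + (c - g) + (g - f))"
      for a b c d e f g :: "real^'n^'n" by (simp add: algebra_simps)
    show ?thesis
      unfolding D'_def D_def tadd tdiff tneg matrix_transpose_mul transpose_transpose R S
        mm.diff_left mm.diff_right matrix_mul_assoc by (rule rearrange)
  qed
  obtain B where B: "B > 0" "\<And>(X :: real^'n^'n) (Y :: real^'n^'n). norm (X ** Y) \<le> norm X * norm Y * B"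
    using mm.pos_bounded by metis
  have contP: "continuous_on {0..T} P"
    by (rule continuous_on_vector_derivative[OF der])
  have bdd: "\<exists>M. \<forall>t\<in>{0..T}. norm (E t) \<le> M"
    if "continuous_on {0..T} E" for E :: "real \<Rightarrow> real^'n^'n"
    using compact_imp_bounded[OF compact_continuous_image[OF that compact_Icc]]
    unfolding bounded_iff by simp
  have "continuous_on {0..T} (\<lambda>t. R ** P t)" "continuous_on {0..T} (\<lambda>t. transpose (P t) ** R)"
    by (intro continuous_on_matrix_matrix continuous_on_const contP bounded_linear.continuous_on[OF bounded_linear_transpose])+
  from this[THEN bdd] obtain M1 M2 where M: "\<And>t. t \<in> {0..T} \<Longrightarrow> norm (R ** P t) \<le> M1"
    "\<And>t. t \<in> {0..T} \<Longrightarrow> norm (transpose (P t) ** R) \<le> M2"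
    by blast
  define K where "K = B * (norm (transpose \<Lambda>) + norm \<Lambda> + M1 + M2)"
  have growth: "norm (D' t) \<le> K * norm (D t)" if t: "t \<in> {0..T}" for t
  proof -
    have "norm (D' t) \<le> norm (transpose \<Lambda> ** D t) + norm (D t ** \<Lambda>) + norm (D t ** (R ** P t))
        + norm ((transpose (P t) ** R) ** D t)"
      unfolding D'_eq norm_minus_cancel by (intro norm_triangle_le add_mono order_refl)
    also have "\<dots> \<le> norm (transpose \<Lambda>) * norm (D t) * B + norm (D t) * norm \<Lambda> * B
        + norm (D t) * M1 * B + M2 * norm (D t) * B"
    proof (intro add_mono)
      show "norm (transpose \<Lambda> ** D t) \<le> norm (transpose \<Lambda>) * norm (D t) * B"
        and "norm (D t ** \<Lambda>) \<le> norm (D t) * norm \<Lambda> * B" by (rule B(2))+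
      have "norm (D t) * norm (R ** P t) * B \<le> norm (D t) * M1 * B"
        by (intro mult_right_mono mult_left_mono M(1) t) (use B(1) in auto)
      then show "norm (D t ** (R ** P t)) \<le> norm (D t) * M1 * B" using B(2) order_trans by blast
      have "norm (transpose (P t) ** R) * norm (D t) * B \<le> M2 * norm (D t) * B"
        by (intro mult_right_mono M(2) t) (use B(1) in auto)
      then show "norm ((transpose (P t) ** R) ** D t) \<le> M2 * norm (D t) * B"
        using B(2) order_trans by blast
    qed
    also have "\<dots> = K * norm (D t)" by (simp add: K_def algebra_simps)
    finally show ?thesis .
  qed
  have "D 0 = 0" unfolding D_def P0 by simp
  from zero_of_linear_growth[OF derD growth this t] have "D t = 0" .
  then show ?thesis by (simp add: D_def)
qed

text \<open>The Hamilton-Jacobi-Bellman equation of the linear-quadratic problem, with the minimization over the control carried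
out by completing the square. The left-hand side is the time derivative of \<open>1/2 z \<bullet> P z + s \<bullet> z + r\<close> along
\<open>z' = \<Lambda> z + w\<close>.\<close>

lemma lq_completion_of_squares:
  fixes R \<Lambda> P :: "real^'n^'n" and Qi :: "real^'p^'p" and C :: "real^'n^'p"
  assumes R: "pos_def R" and P: "transpose P = P" and Qi: "transpose Qi = Qi"
    and dz: "dz = \<Lambda> *v z + w"
    and dP: "dP = - (transpose \<Lambda> ** P + P ** \<Lambda> + P ** R ** P - transpose C ** Qi ** C)"
    and ds: "ds = - (transpose \<Lambda> *v s + (P ** R) *v s + (transpose C ** Qi) *v y)"
    and dr: "dr = - (1/2 * (s \<bullet> (R *v s)) - 1/2 * (y \<bullet> (Qi *v y)))"
    and e: "e = w - R *v (P *v z + s)"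
  shows "1/2 * (dz \<bullet> (P *v z) + z \<bullet> (dP *v z + P *v dz)) + (ds \<bullet> z + s \<bullet> dz) + dr
       = 1/2 * ((y - C *v z) \<bullet> (Qi *v (y - C *v z))) + 1/2 * (w \<bullet> (matrix_inv R *v w))
         - 1/2 * (e \<bullet> (matrix_inv R *v e))"
proof -
  have Rsym: "transpose R = R" using R by (simp add: pos_def_def)
  note Ri = matrix_inv_cancel[OF pos_def_invertible[OF R]]
  have Risym: "transpose (matrix_inv R) = matrix_inv R" using pos_def_matrix_inv[OF R] by (simp add: pos_def_def)
  note sR = symmetric_inner[OF Rsym] and sP = symmetric_inner[OF P] and sQ = symmetric_inner[OF Qi]
    and sRi = symmetric_inner[OF Risym]
  define p where "p = P *v z + s"
  define a where "a = \<Lambda> *v z"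
  define b where "b = C *v z"
  have neg: "(- A) *v x = - (A *v x)" for A :: "real^'n^'n" and x by (metis diff_0 matrix_vector_mult_0 matrix_vector_mult_diff_rdistrib)
  have swap_t: "x \<bullet> (transpose \<Lambda> *v v) = v \<bullet> (\<Lambda> *v x)" for x v
    using transpose_matrix_vector_inner[of \<Lambda> v x] by (simp add: inner_commute del: transpose_matrix_vector)
  have swap_c: "x \<bullet> (transpose C *v v) = v \<bullet> (C *v x)" for x v
    using transpose_matrix_vector_inner[of C v x] by (simp add: inner_commute del: transpose_matrix_vector)
  have zP: "z \<bullet> (P *v x) = (P *v z) \<bullet> x" for x using sP[of z x] by simp
  have q1: "z \<bullet> (dP *v z) = - (2 * ((P *v z) \<bullet> a) + (P *v z) \<bullet> (R *v (P *v z)) - b \<bullet> (Qi *v b))"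
    unfolding dP neg matrix_vector_mult_diff_rdistrib matrix_vector_mult_add_rdistrib
      matrix_vector_mul_assoc[symmetric] inner_minus_right inner_diff_right inner_add_right swap_t swap_c zP
    by (simp add: a_def b_def inner_commute)
  have q2: "ds \<bullet> z = - (s \<bullet> a + (P *v z) \<bullet> (R *v s) + b \<bullet> (Qi *v y))"
    unfolding ds inner_minus_left inner_add_left matrix_vector_mul_assoc[symmetric] transpose_matrix_vector_inner
    by (simp add: a_def b_def sP inner_commute)
  have q3: "e \<bullet> (matrix_inv R *v e) = w \<bullet> (matrix_inv R *v w) - 2 * (w \<bullet> p) + p \<bullet> (R *v p)"
    using sRi[of "R *v p" w] sR[of p w]
    by (simp add: e p_def[symmetric] matrix_vector_mult_diff_distrib inner_diff_left inner_diff_right Ri)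
       (simp add: inner_commute)
  have q4: "p \<bullet> (R *v p) = (P *v z) \<bullet> (R *v (P *v z)) + 2 * ((P *v z) \<bullet> (R *v s)) + s \<bullet> (R *v s)"
    using sR[of s "P *v z"]
    by (simp add: p_def matrix_vector_right_distrib inner_add_left inner_add_right inner_commute)
  have q5: "(y - b) \<bullet> (Qi *v (y - b)) = y \<bullet> (Qi *v y) - 2 * (b \<bullet> (Qi *v y)) + b \<bullet> (Qi *v b)"
    using sQ[of y b]
    by (simp add: matrix_vector_mult_diff_distrib inner_diff_left inner_diff_right inner_commute)
  have q6: "dz \<bullet> (P *v z) = (P *v z) \<bullet> a + (P *v z) \<bullet> w" "s \<bullet> dz = s \<bullet> a + s \<bullet> w"
    by (simp_all add: dz a_def inner_add_left inner_add_right inner_commute)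
  have q7: "w \<bullet> p = (P *v z) \<bullet> w + s \<bullet> w" by (simp add: p_def inner_add_right inner_commute)
  show ?thesis
    unfolding inner_add_right zP q1 q2 q3 q4 b_def[symmetric] q5 q7 dr
    using q6 by (simp add: inner_commute add_divide_distrib diff_divide_distrib)
qed

lemma has_integral_Pair:
  fixes f :: "'c::euclidean_space \<Rightarrow> 'a::euclidean_space" and g :: "'c \<Rightarrow> 'b::euclidean_space"
  assumes "(f has_integral a) S" and "(g has_integral b) S"
  shows "((\<lambda>x. (f x, g x)) has_integral (a, b)) S"
  using has_integral_add[OF has_integral_linear[OF assms(1), of "\<lambda>u. (u, 0)"]
      has_integral_linear[OF assms(2), of "\<lambda>u. (0, u)"]]
  by (simp add: o_def bounded_linear_Pair bounded_linear_ident bounded_linear_zero)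

lemma absolutely_integrable_Pair:
  fixes f :: "'c::euclidean_space \<Rightarrow> 'a::euclidean_space" and g :: "'c \<Rightarrow> 'b::euclidean_space"
  assumes "f absolutely_integrable_on S" and "g absolutely_integrable_on S"
  shows "(\<lambda>x. (f x, g x)) absolutely_integrable_on S"
  using set_integral_add(1)[OF absolutely_integrable_linear[OF assms(1), of "\<lambda>u. (u, 0)"]
      absolutely_integrable_linear[OF assms(2), of "\<lambda>u. (0, u)"]]
  by (simp add: o_def bounded_linear_Pair bounded_linear_ident bounded_linear_zero)

text \<open>The chain rule applied to the path \<open>(z, s, P, r)\<close> and to the polynomial that evaluates \<open>v\<close>; the resulting integrand is the one
computed by completing the square.\<close>

lemma lq_verification_identity:
  fixes R \<Lambda> :: "real^'n^'n" and P :: "real \<Rightarrow> real^'n^'n" and Qi :: "real^'p^'p" and C :: "real^'n^'p"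
    and y :: "real \<Rightarrow> real^'p" and z w s :: "real \<Rightarrow> real^'n" and r :: "real \<Rightarrow> real"
  assumes t: "0 \<le> t" and R: "pos_def R" and Qi: "transpose Qi = Qi" and Qi_nonneg: "\<And>v. v \<bullet> (Qi *v v) \<ge> 0"
    and P: "\<And>\<tau>. \<tau> \<in> {0..t} \<Longrightarrow> (P has_vector_derivative
           - (transpose \<Lambda> ** P \<tau> + P \<tau> ** \<Lambda> + P \<tau> ** R ** P \<tau> - transpose C ** Qi ** C)) (at \<tau> within {0..t})"
    and Psym: "\<And>\<tau>. \<tau> \<in> {0..t} \<Longrightarrow> transpose (P \<tau>) = P \<tau>"
    and s: "integral_solution t
           (\<lambda>\<tau>. - (transpose \<Lambda> *v s \<tau> + (P \<tau> ** R) *v s \<tau> + (transpose C ** Qi) *v y \<tau>)) s"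
    and r: "integral_solution t
           (\<lambda>\<tau>. - (1/2 * (s \<tau> \<bullet> (R *v s \<tau>)) - 1/2 * (y \<tau> \<bullet> (Qi *v y \<tau>)))) r"
    and y: "y square_integrable_on {0..t}"
    and z: "integral_solution t (\<lambda>\<tau>. \<Lambda> *v z \<tau> + w \<tau>) z"
    and w: "w square_integrable_on {0..t}"
    and v_def: "\<And>\<tau> \<zeta>. v \<tau> \<zeta> = 1/2 * (\<zeta> \<bullet> (P \<tau> *v \<zeta>)) + s \<tau> \<bullet> \<zeta> + r \<tau>"
    and e_def: "\<And>\<tau>. e \<tau> = w \<tau> - R *v (P \<tau> *v z \<tau> + s \<tau>)"
  shows "((\<lambda>\<tau>. 1/2 * ((y \<tau> - C *v z \<tau>) \<bullet> (Qi *v (y \<tau> - C *v z \<tau>))) + 1/2 * (w \<tau> \<bullet> (matrix_inv R *v w \<tau>))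
            - 1/2 * (e \<tau> \<bullet> (matrix_inv R *v e \<tau>))) has_integral (v t (z t) - v 0 (z 0))) {0..t}"
proof -
  define dz where "dz = (\<lambda>\<tau>. \<Lambda> *v z \<tau> + w \<tau>)"
  define dP where "dP = (\<lambda>\<tau>. - (transpose \<Lambda> ** P \<tau> + P \<tau> ** \<Lambda> + P \<tau> ** R ** P \<tau> - transpose C ** Qi ** C))"
  define ds where "ds = (\<lambda>\<tau>. - (transpose \<Lambda> *v s \<tau> + (P \<tau> ** R) *v s \<tau> + (transpose C ** Qi) *v y \<tau>))"
  define dr where "dr = (\<lambda>\<tau>. - (1/2 * (s \<tau> \<bullet> (R *v s \<tau>)) - 1/2 * (y \<tau> \<bullet> (Qi *v y \<tau>))))"
  have iz: "(dz has_integral (z \<tau> - z 0)) {0..\<tau>}" and i_s: "(ds has_integral (s \<tau> - s 0)) {0..\<tau>}"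
    and ir: "(dr has_integral (r \<tau> - r 0)) {0..\<tau>}" if "\<tau> \<in> {0..t}" for \<tau>
    using z s r that by (auto simp: integral_solution_def dz_def ds_def dr_def)
  have iP: "(dP has_integral (P \<tau> - P 0)) {0..\<tau>}" if "\<tau> \<in> {0..t}" for \<tau>
  proof (rule fundamental_theorem_of_calculus)
    fix x assume "x \<in> {0..\<tau>}"
    then show "(P has_vector_derivative dP x) (at x within {0..\<tau>})"
      unfolding dP_def using that
      by (intro has_vector_derivative_within_subset[OF P]) auto
  qed (use that in auto)
  have cz: "continuous_on {0..t} z" and cs: "continuous_on {0..t} s" and cP: "continuous_on {0..t} P"
    using path_continuous[of 0 t] iz i_s iP by blast+
  have az: "dz absolutely_integrable_on {0..t}"
    unfolding dz_def using w
    by (intro set_integral_add square_integrable_absolutely absolutely_integrable_continuous_real continuous_intros cz)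
  have ads: "ds absolutely_integrable_on {0..t}"
  proof -
    have "(\<lambda>\<tau>. transpose \<Lambda> *v s \<tau> + (P \<tau> ** R) *v s \<tau>) absolutely_integrable_on {0..t}"
      by (intro absolutely_integrable_continuous_real continuous_intros cs cP)
    moreover have "(\<lambda>\<tau>. (transpose C ** Qi) *v y \<tau>) absolutely_integrable_on {0..t}"
      by (intro square_integrable_absolutely square_integrable_matrix y)
    ultimately have "(\<lambda>\<tau>. transpose \<Lambda> *v s \<tau> + (P \<tau> ** R) *v s \<tau> + (transpose C ** Qi) *v y \<tau>)
        absolutely_integrable_on {0..t}" by (rule set_integral_add)
    from absolutely_integrable_scaleR_left[OF this, of "-1"] show ?thesis by (simp add: ds_def)
  qed
  have adr: "dr absolutely_integrable_on {0..t}"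
  proof -
    have "(\<lambda>\<tau>. - (1/2 * (s \<tau> \<bullet> (R *v s \<tau>)))) absolutely_integrable_on {0..t}"
      by (intro absolutely_integrable_continuous_real continuous_intros cs)
    moreover have "(\<lambda>\<tau>. 1/2 * (y \<tau> \<bullet> (Qi *v y \<tau>))) absolutely_integrable_on {0..t}"
      by (intro nonnegative_absolutely_integrable_1 integrable_on_mult_right
          square_integrable_quadratic_form y) (simp add: Qi_nonneg)
    ultimately have "(\<lambda>\<tau>. - (1/2 * (s \<tau> \<bullet> (R *v s \<tau>))) + 1/2 * (y \<tau> \<bullet> (Qi *v y \<tau>)))
        absolutely_integrable_on {0..t}" by (rule set_integral_add)
    then show ?thesis by (simp add: dr_def)
  qed
  have adP: "dP absolutely_integrable_on {0..t}"
    unfolding dP_def by (intro absolutely_integrable_continuous_real continuous_intros cP)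
  define X where "X = (\<lambda>\<tau>. (z \<tau>, s \<tau>, P \<tau>, r \<tau>))"
  define X' where "X' = (\<lambda>\<tau>. (dz \<tau>, ds \<tau>, dP \<tau>, dr \<tau>))"
  define G where "G = (\<lambda>p :: (real^'n) \<times> (real^'n) \<times> (real^'n^'n) \<times> real.
     1/2 * (fst p \<bullet> (fst (snd (snd p)) *v fst p)) + fst (snd p) \<bullet> fst p + snd (snd (snd p)))"
  define G' where "G' = (\<lambda>(p :: (real^'n) \<times> (real^'n) \<times> (real^'n^'n) \<times> real) (q :: (real^'n) \<times> (real^'n) \<times> (real^'n^'n) \<times> real).
     1/2 * (fst q \<bullet> (fst (snd (snd p)) *v fst p)
            + fst p \<bullet> (fst (snd (snd q)) *v fst p + fst (snd (snd p)) *v fst q))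
     + (fst (snd q) \<bullet> fst p + fst (snd p) \<bullet> fst q) + snd (snd (snd q)))"
  have "((\<lambda>\<tau>. G' (X \<tau>) (X' \<tau>)) has_integral (G (X t) - G (X 0))) {0..t}"
  proof (rule has_integral_chain_rule[where G = G and G' = G' and x = X and g = X' and a = 0 and b = t])
    show "X' absolutely_integrable_on {0..t}"
      unfolding X'_def by (intro absolutely_integrable_Pair az ads adr adP)
    show "(X' has_integral (X \<tau> - X 0)) {0..\<tau>}" if "\<tau> \<in> {0..t}" for \<tau>
      unfolding X_def X'_def diff_Pair using that by (intro has_integral_Pair iz i_s iP ir)
    show "(G has_derivative G' p) (at p)" for p
    proof -
      have mv: "((\<lambda>p. fst (snd (snd p)) *v fst p) has_derivative
          (\<lambda>q. fst (snd (snd p)) *v fst q + fst (snd (snd q)) *v fst p)) (at p)"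
        for p :: "(real^'n) \<times> (real^'n) \<times> (real^'n^'n) \<times> real"
        by (rule bounded_bilinear.FDERIV[OF bounded_bilinear_matrix_vector]) (auto intro!: derivative_eq_intros)
      show ?thesis
        unfolding G_def
        by (rule has_derivative_eq_rhs, (rule derivative_intros mv)+)
           (auto simp: G'_def fun_eq_iff algebra_simps inner_commute)
    qed
    show "continuous_on UNIV (\<lambda>p. G' p q)" for q
      unfolding G'_def by (intro continuous_intros)
  qed (use t in auto)
  moreover have "G (X \<tau>) = v \<tau> (z \<tau>)" for \<tau> by (simp add: G_def X_def v_def)
  ultimately have main: "((\<lambda>\<tau>. G' (X \<tau>) (X' \<tau>)) has_integral (v t (z t) - v 0 (z 0))) {0..t}" by simp
  show ?thesis
  proof (rule has_integral_eq[OF _ main])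
    fix \<tau> assume \<tau>: "\<tau> \<in> {0..t}"
    show "G' (X \<tau>) (X' \<tau>) = 1/2 * ((y \<tau> - C *v z \<tau>) \<bullet> (Qi *v (y \<tau> - C *v z \<tau>)))
        + 1/2 * (w \<tau> \<bullet> (matrix_inv R *v w \<tau>)) - 1/2 * (e \<tau> \<bullet> (matrix_inv R *v e \<tau>))"
      unfolding lq_completion_of_squares[OF R Psym[OF \<tau>] Qi fun_cong[OF dz_def] fun_cong[OF dP_def]
          fun_cong[OF ds_def] fun_cong[OF dr_def] e_def, symmetric]
      by (simp add: G'_def X_def X'_def)
  qed
qed

section \<open>Changes of coordinates\<close>

lemma continuous_on_matrix:
  fixes A :: "'t::topological_space \<Rightarrow> real^'n^'m"
  assumes "\<And>v. continuous_on S (\<lambda>x. A x *v v)"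
  shows "continuous_on S A"
proof -
  have eq: "A = (\<lambda>x. \<chi> i j. (A x *v axis j 1) $ i)"
    by (simp add: fun_eq_iff vec_eq_iff matrix_vector_mult_basis column_def)
  show ?thesis
    by (subst eq) (intro continuous_on_vec_lambda continuous_on_component assms)
qed

lemma Ck_1_jacobian:
  fixes \<Phi> :: "real^'n \<Rightarrow> real^'m"
  assumes "Ck 1 \<Phi>"
  shows "(\<Phi> has_derivative (\<lambda>v. jacobian \<Phi> (at x) *v v)) (at x)"
    and "continuous_on S (\<lambda>x. jacobian \<Phi> (at x))"
proof -
  have diff: "\<Phi> differentiable (at x)" and cont: "continuous_on UNIV (\<lambda>x. frechet_derivative \<Phi> (at x) v)" for x v
    using assms unfolding One_nat_def by simp_all
  show der: "(\<Phi> has_derivative (\<lambda>v. jacobian \<Phi> (at x) *v v)) (at x)" for x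
    using diff jacobian_works by blast
  have "frechet_derivative \<Phi> (at x) = (\<lambda>v. jacobian \<Phi> (at x) *v v)" for x
    using frechet_derivative_at[OF der] by simp
  then have "continuous_on UNIV (\<lambda>x. jacobian \<Phi> (at x) *v v)" for v using cont[of v] by simp
  then have "continuous_on UNIV (\<lambda>x. jacobian \<Phi> (at x))" by (rule continuous_on_matrix)
  then show "continuous_on S (\<lambda>x. jacobian \<Phi> (at x))" by (rule continuous_on_subset) simp
qed

text \<open>The image is open by invariance of domain. It is closed because preimages of bounded sets are bounded: a convergent
sequence of values comes from a compact ball, whose image is closed. A nonempty open and closed set is the whole space.\<close>

lemma coercive_injection_surj:
  fixes \<Phi> :: "'a::euclidean_space \<Rightarrow> 'a"
  assumes cont: "continuous_on UNIV \<Phi>" and inj: "inj \<Phi>"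
    and growth: "\<And>x. norm (x - a) \<le> K * norm (\<Phi> x - b)"
  shows "surj \<Phi>"
proof -
  have "open (range \<Phi>)" by (rule invariance_of_domain[OF cont open_UNIV inj])
  moreover have "closed (range \<Phi>)"
    unfolding closed_sequential_limits
  proof (intro allI impI, elim conjE)
    fix X l assume X: "\<forall>n. X n \<in> range \<Phi>" and lim: "X \<longlonglongrightarrow> l"
    obtain M where M: "\<And>n. norm (X n) \<le> M"
      using convergent_imp_bounded[OF lim] by (auto simp: bounded_iff)
    have "X n \<in> \<Phi> ` cball a (\<bar>K\<bar> * (M + norm b))" for n
    proof -
      obtain x where x: "X n = \<Phi> x" using X by blast
      have "norm (x - a) \<le> \<bar>K\<bar> * norm (\<Phi> x - b)"
        by (rule order_trans[OF growth mult_right_mono]) auto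
      also have "\<dots> \<le> \<bar>K\<bar> * (M + norm b)"
        using norm_triangle_ineq4[of "\<Phi> x" b] M[of n] x by (intro mult_left_mono) auto
      finally show ?thesis using x by (auto simp: dist_norm norm_minus_commute)
    qed
    moreover have "closed (\<Phi> ` cball a (\<bar>K\<bar> * (M + norm b)))"
      by (intro compact_imp_closed compact_continuous_image continuous_on_subset[OF cont]) auto
    ultimately have "l \<in> \<Phi> ` cball a (\<bar>K\<bar> * (M + norm b))"
      using lim closed_sequentially by blast
    then show "l \<in> range \<Phi>" by blast
  qed
  ultimately show ?thesis using clopen by blast
qed

text \<open>The inverse is continuous, since invariance of domain makes \<open>\<Phi>\<close> an open map; the derivative of a continuous inverse is the
inverse of the derivative.\<close>

lemma inverse_has_derivative:
  fixes \<Phi> :: "real^'n \<Rightarrow> real^'n"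
  assumes der: "\<And>x. (\<Phi> has_derivative (\<lambda>v. J x *v v)) (at x)"
    and inv: "\<And>x. invertible (J x)" and bij: "bij \<Phi>"
  shows "(inv \<Phi> has_derivative (\<lambda>v. matrix_inv (J (inv \<Phi> z)) *v v)) (at z)"
proof (rule has_derivative_inverse_basic[OF der])
  have cont: "continuous_on UNIV \<Phi>"
    by (rule has_derivative_continuous_on) (rule has_derivative_at_withinI[OF der])
  have "open (\<Phi> ` U)" if "open U" for U
    using that bij by (intro invariance_of_domain continuous_on_subset[OF cont])
      (auto simp: bij_def intro: inj_on_subset)
  moreover have "inv \<Phi> -` U = \<Phi> ` U" for U
    using bij by (simp add: bij_vimage_eq_inv_image inv_inv_eq bij_imp_bij_inv)
  ultimately have "continuous_on UNIV (inv \<Phi>)"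
    by (simp add: continuous_on_open_vimage)
  then show "continuous (at z) (inv \<Phi>)" by (simp add: continuous_on_eq_continuous_at)
  show "(\<lambda>v. matrix_inv (J (inv \<Phi> z)) *v v) \<circ> (\<lambda>v. J (inv \<Phi> z) *v v) = id"
    by (simp add: fun_eq_iff matrix_inv_cancel[OF inv])
  show "\<And>z. z \<in> UNIV \<Longrightarrow> \<Phi> (inv \<Phi> z) = z" using bij by (simp add: bij_is_surj surj_f_inv_f)
qed (auto intro: matrix_vector_mul_bounded_linear)

section \<open>The filter in eigenfunction coordinates\<close>

text \<open>\<open>\<Phi>\<close> is only required to be injective here: surjectivity is a consequence of the growth condition, and it is derived from the
formula for \<open>v\<close> at time 0. The bounds on \<open>h\<close> and \<open>y\<close> enter later, because the integrability of \<open>\<delta>\<close> rests on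
the square integrability of \<open>y\<close>.\<close>

locale eigenfunction_coordinates =
  fixes f :: "real^'n \<Rightarrow> real^'n" and h :: "real^'n \<Rightarrow> real^'p"
    and R \<Sigma> \<Lambda> :: "real^'n^'n" and Q :: "real^'p^'p" and C :: "real^'n^'p"
    and \<mu> :: "real^'n" and T :: real and y :: "real \<Rightarrow> real^'p"
    and \<Phi> :: "real^'n \<Rightarrow> real^'n"
    and P :: "real \<Rightarrow> real^'n^'n" and s :: "real \<Rightarrow> real^'n" and r :: "real \<Rightarrow> real"
  assumes T: "0 \<le> T"
    and cont_f: "continuous_on UNIV f" and cont_h: "continuous_on UNIV h"
    and R: "pos_def R" and Q: "pos_def Q" and \<Sigma>: "pos_def \<Sigma>"
    and y_meas: "y \<in> borel_measurable (lebesgue_on {0..T})"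
    and der_\<Phi>: "\<And>x. (\<Phi> has_derivative (\<lambda>v. jacobian \<Phi> (at x) *v v)) (at x)"
    and cont_J: "\<And>S. continuous_on S (\<lambda>x. jacobian \<Phi> (at x))"
    and inv_J: "\<And>x. invertible (jacobian \<Phi> (at x))"
    and koopman: "\<And>x. jacobian \<Phi> (at x) *v f x = \<Lambda> *v \<Phi> x"
    and inj_\<Phi>: "inj \<Phi>"
    and P: "\<And>t. t \<in> {0..T} \<Longrightarrow> (P has_vector_derivative
           - (transpose \<Lambda> ** P t + P t ** \<Lambda> + P t ** R ** P t
              - transpose C ** matrix_inv Q ** C)) (at t within {0..T})"
    and P0: "P 0 = matrix_inv \<Sigma>"
    and s: "integral_solution T
           (\<lambda>t. - (transpose \<Lambda> *v s t + (P t ** R) *v s t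
                  + (transpose C ** matrix_inv Q) *v y t)) s"
    and s0: "s 0 = - (matrix_inv \<Sigma> *v \<Phi> \<mu>)"
    and r: "integral_solution T
           (\<lambda>t. - (1/2 * (s t \<bullet> (R *v s t)) - 1/2 * (y t \<bullet> (matrix_inv Q *v y t)))) r"
    and r0: "r 0 = 1/2 * (\<Phi> \<mu> \<bullet> (matrix_inv \<Sigma> *v \<Phi> \<mu>))"
begin

abbreviation J where "J x \<equiv> jacobian \<Phi> (at x)"

text \<open>The value function of the linear-quadratic problem; the approximate value function is \<open>\<lambda>x t. v t (\<Phi> x)\<close>.\<close>

definition v :: "real \<Rightarrow> real^'n \<Rightarrow> real" where
  "v t \<zeta> = 1/2 * (\<zeta> \<bullet> (P t *v \<zeta>)) + s t \<bullet> \<zeta> + r t"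

definition misfit :: "real \<Rightarrow> real^'p \<Rightarrow> real" where
  "misfit \<tau> \<eta> = (y \<tau> - \<eta>) \<bullet> (matrix_inv Q *v (y \<tau> - \<eta>))"

lemma Qi: "pos_def (matrix_inv Q)" and Ri: "pos_def (matrix_inv R)" and \<Sigma>i: "pos_def (matrix_inv \<Sigma>)"
  by (intro pos_def_matrix_inv Q R \<Sigma>)+

lemma weights_symmetric: "transpose (matrix_inv Q) = matrix_inv Q" "transpose (matrix_inv \<Sigma>) = matrix_inv \<Sigma>" "transpose R = R"
  using Qi \<Sigma>i R by (simp_all add: pos_def_def)

lemma cont_\<Phi>: "continuous_on S \<Phi>"
  by (rule has_derivative_continuous_on) (rule has_derivative_at_withinI[OF der_\<Phi>])

lemma cont_P: "continuous_on {0..T} P" by (rule continuous_on_vector_derivative[OF P])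

lemma cont_s: "continuous_on {0..T} s"
  using s unfolding integral_solution_def by (intro path_continuous) auto

text \<open>The equation for \<open>r\<close> presupposes that \<open>y \<bullet> (Q\<inverse> y)\<close> is integrable, the other term being continuous.\<close>

lemma y_square_integrable: "y square_integrable_on {0..T}"
proof -
  obtain k where k: "k > 0" "\<And>\<eta>. k * (norm \<eta>)\<^sup>2 \<le> \<eta> \<bullet> (matrix_inv Q *v \<eta>)"
    using pos_def_coercive[OF Qi] by blast
  let ?rr = "\<lambda>t. - (1/2 * (s t \<bullet> (R *v s t)) - 1/2 * (y t \<bullet> (matrix_inv Q *v y t)))"
  have "?rr integrable_on {0..T}"
    using r T unfolding integral_solution_def by auto
  moreover have "(\<lambda>t. s t \<bullet> (R *v s t)) integrable_on {0..T}"
    by (intro integrable_continuous_real continuous_intros cont_s)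
  ultimately have "(\<lambda>t. (2/k) * ?rr t + (1/k) * (s t \<bullet> (R *v s t))) integrable_on {0..T}"
    by (intro integrable_add integrable_on_mult_right)
  then have "(\<lambda>t. (1/k) * (y t \<bullet> (matrix_inv Q *v y t))) integrable_on {0..T}"
    by (rule integrable_eq) (use k(1) in \<open>simp add: field_simps\<close>)
  then show ?thesis
    by (rule square_integrable_dominated[OF y_meas]) (use k in \<open>simp add: field_simps\<close>)
qed

lemma P_symmetric: "t \<in> {0..T} \<Longrightarrow> transpose (P t) = P t"
  by (rule riccati_symmetric[OF P weights_symmetric(3)])
     (auto simp: P0 weights_symmetric matrix_transpose_mul matrix_mul_assoc)

lemma v_initial: "v 0 \<zeta> = 1/2 * ((\<zeta> - \<Phi> \<mu>) \<bullet> (matrix_inv \<Sigma> *v (\<zeta> - \<Phi> \<mu>)))"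
  using symmetric_inner[OF weights_symmetric(2), of "\<Phi> \<mu>" \<zeta>]
  unfolding v_def P0 s0 r0
  by (simp add: matrix_vector_mult_diff_distrib inner_diff_left inner_diff_right inner_commute)

text \<open>At time 0 the approximate value function is a squared distance to \<open>\<Phi> \<mu>\<close> in the coordinates \<open>\<Phi>\<close>, so its quadratic
growth in \<open>x\<close> bounds the distance in the original coordinates by the distance of the images.\<close>

lemma surj_of_quadratic_growth:
  assumes growth: "\<And>x. v 0 (\<Phi> x) \<ge> v 0 (\<Phi> a) + \<gamma> / 2 * (norm (a - x))\<^sup>2" and \<gamma>: "\<gamma> > 0"
  shows "surj \<Phi>"
proof (rule coercive_injection_surj[OF cont_\<Phi> inj_\<Phi>])
  fix x
  define l where "l = lambda_max (matrix_inv \<Sigma>)"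
  have "0 \<le> v 0 (\<Phi> a)" unfolding v_initial using pos_def_nonneg[OF \<Sigma>i] by simp
  moreover have "v 0 (\<Phi> x) \<le> 1/2 * (l * (norm (\<Phi> x - \<Phi> \<mu>))\<^sup>2)"
    unfolding v_initial l_def by (intro mult_left_mono rayleigh_le_lambda_max weights_symmetric) simp
  ultimately have "\<gamma> * (norm (x - a))\<^sup>2 \<le> l * (norm (\<Phi> x - \<Phi> \<mu>))\<^sup>2"
    using growth[of x] by (simp add: norm_minus_commute)
  then have "(norm (x - a))\<^sup>2 \<le> l / \<gamma> * (norm (\<Phi> x - \<Phi> \<mu>))\<^sup>2" using \<gamma> by (simp add: field_simps)
  then have "norm (x - a) \<le> sqrt (l / \<gamma> * (norm (\<Phi> x - \<Phi> \<mu>))\<^sup>2)" by (rule real_le_rsqrt)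
  then show "norm (x - a) \<le> sqrt (l / \<gamma>) * norm (\<Phi> x - \<Phi> \<mu>)"
    by (simp only: real_sqrt_mult real_sqrt_abs abs_norm_cancel)
qed


lemma verification:
  assumes t: "t \<in> {0..T}" and z: "integral_solution t (\<lambda>\<tau>. \<Lambda> *v z \<tau> + w \<tau>) z"
    and w: "w square_integrable_on {0..t}"
  shows "((\<lambda>\<tau>. 1/2 * misfit \<tau> (C *v z \<tau>) + 1/2 * (w \<tau> \<bullet> (matrix_inv R *v w \<tau>))
            - 1/2 * ((w \<tau> - R *v (P \<tau> *v z \<tau> + s \<tau>)) \<bullet> (matrix_inv R *v (w \<tau> - R *v (P \<tau> *v z \<tau> + s \<tau>)))))
          has_integral (v t (z t) - v 0 (z 0))) {0..t}"
  unfolding misfit_def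
proof (rule lq_verification_identity[OF _ R weights_symmetric(1) pos_def_nonneg[OF Qi] _ P_symmetric _ _ _ z w v_def])
  fix \<tau> assume "\<tau> \<in> {0..t}"
  then show "(P has_vector_derivative - (transpose \<Lambda> ** P \<tau> + P \<tau> ** \<Lambda> + P \<tau> ** R ** P \<tau>
               - transpose C ** matrix_inv Q ** C)) (at \<tau> within {0..t})"
    using t by (intro has_vector_derivative_within_subset[OF P]) auto
qed (use t s r y_square_integrable in \<open>auto simp: integral_solution_def intro: square_integrable_subset\<close>)

lemma R1_quadratic:
  "u \<bullet> (R1 \<Phi> R x *v u) = (J x *v u) \<bullet> (matrix_inv R *v (J x *v u))"
  using transpose_matrix_vector_inner[of "J x" "matrix_inv R *v (J x *v u)" u]
  by (simp add: R1_def matrix_vector_mul_assoc[symmetric] inner_commute del: transpose_matrix_vector)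

lemma R1_coercive_along_path:
  fixes x :: "real \<Rightarrow> real^'n" and t :: real
  assumes x: "continuous_on {0..t} x"
  obtains k where "k > 0" and "\<And>\<tau> u. \<tau> \<in> {0..t} \<Longrightarrow> k * (norm u)\<^sup>2 \<le> u \<bullet> (R1 \<Phi> R (x \<tau>) *v u)"
proof -
  have "continuous_on {0..t} (\<lambda>\<tau>. J (x \<tau>))"
    by (rule continuous_on_compose2[OF cont_J[of UNIV] x]) auto
  then have cont: "continuous_on {0..t} (\<lambda>\<tau>. R1 \<Phi> R (x \<tau>))"
    unfolding R1_def by (intro continuous_intros bounded_linear.continuous_on[OF bounded_linear_transpose])
  have pos: "u \<bullet> (R1 \<Phi> R (x \<tau>) *v u) > 0" if "\<tau> \<in> {0..t}" "u \<noteq> 0" for \<tau> and u :: "real^'n"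
  proof -
    have "J (x \<tau>) *v u \<noteq> 0" using matrix_inv_cancel(2)[OF inv_J, of "x \<tau>" u] that by auto
    then have "(J (x \<tau>) *v u) \<bullet> (matrix_inv R *v (J (x \<tau>) *v u)) > 0" using Ri by (simp add: pos_def_def)
    then show ?thesis unfolding R1_quadratic .
  qed
  show thesis
    using uniformly_coercive[OF compact_Icc cont pos] that by blast
qed

end

section \<open>Comparison of the two value functions\<close>

locale eigenfunction_filter = eigenfunction_coordinates f h R \<Sigma> \<Lambda> Q C \<mu> T y \<Phi> P s r
  for f :: "real^'n \<Rightarrow> real^'n" and h :: "real^'n \<Rightarrow> real^'p" and R \<Sigma> \<Lambda> Q C \<mu> T y \<Phi> P s r +
  fixes \<delta>\<^sub>h :: real and \<delta> :: "real \<Rightarrow> real"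
  assumes surj_\<Phi>: "surj \<Phi>"
    and \<delta>h: "\<And>x. norm (h x - C *v \<Phi> x) \<le> \<delta>\<^sub>h"
    and \<delta>: "\<And>t x. t \<in> {0..T} \<Longrightarrow> norm (y t - h x) \<le> \<delta> t"
    and \<delta>_int: "\<delta> integrable_on {0..T}"
begin

definition err :: "real \<Rightarrow> real" where
  "err t = lambda_max (matrix_inv Q) * integral {0..t} (\<lambda>\<tau>. \<delta>\<^sub>h * (\<delta>\<^sub>h / 2 + \<delta> \<tau>))"

lemma bij_\<Phi>: "bij \<Phi>" using inj_\<Phi> surj_\<Phi> by (simp add: bij_def)

text \<open>With \<open>a = y - h x\<close> and \<open>b = h x - C \<Phi> x\<close> the two misfits are the forms of \<open>a + b\<close> and of \<open>a\<close>, and the cross term is bounded by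
the product of the norms.\<close>

lemma misfit_perturbation:
  assumes \<tau>: "\<tau> \<in> {0..T}"
  shows "\<bar>misfit \<tau> (C *v \<Phi> x) - misfit \<tau> (h x)\<bar>
           \<le> 2 * (lambda_max (matrix_inv Q) * (\<delta>\<^sub>h * (\<delta>\<^sub>h / 2 + \<delta> \<tau>)))"
proof -
  define a where "a = y \<tau> - h x"
  define b where "b = h x - C *v \<Phi> x"
  define l where "l = lambda_max (matrix_inv Q)"
  have ab: "y \<tau> - C *v \<Phi> x = a + b" by (simp add: a_def b_def)
  have swap: "b \<bullet> (matrix_inv Q *v a) = a \<bullet> (matrix_inv Q *v b)"
    using symmetric_inner[OF weights_symmetric(1), of b a] by (simp add: inner_commute)
  have eq: "misfit \<tau> (C *v \<Phi> x) - misfit \<tau> (h x)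
      = 2 * (a \<bullet> (matrix_inv Q *v b)) + b \<bullet> (matrix_inv Q *v b)"
    unfolding misfit_def ab unfolding a_def[symmetric]
    by (simp add: matrix_vector_right_distrib inner_add_left inner_add_right swap)
  have l: "l \<ge> 0"
  proof -
    have "0 < axis undefined 1 \<bullet> (matrix_inv Q *v (axis undefined 1 :: real^'p))"
      using Qi unfolding pos_def_def by (metis axis_eq_0_iff one_neq_zero)
    also have "\<dots> \<le> l * (norm (axis undefined 1 :: real^'p))\<^sup>2"
      unfolding l_def by (rule rayleigh_le_lambda_max[OF weights_symmetric(1)])
    finally show ?thesis by simp
  qed
  have na: "norm a \<le> \<delta> \<tau>" and nb: "norm b \<le> \<delta>\<^sub>h" using \<delta>[OF \<tau>] \<delta>h by (auto simp: a_def b_def)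
  then have pos: "\<delta> \<tau> \<ge> 0" "\<delta>\<^sub>h \<ge> 0" using norm_ge_zero order_trans by blast+
  have "\<bar>a \<bullet> (matrix_inv Q *v b)\<bar> \<le> l * norm a * norm b" "\<bar>b \<bullet> (matrix_inv Q *v b)\<bar> \<le> l * norm b * norm b"
    unfolding l_def by (rule pos_def_inner_le[OF Qi])+
  moreover have "l * norm a * norm b \<le> l * \<delta> \<tau> * \<delta>\<^sub>h" "l * norm b * norm b \<le> l * \<delta>\<^sub>h * \<delta>\<^sub>h"
    using l na nb pos by (intro mult_mono; simp)+
  moreover have "2 * (l * (\<delta>\<^sub>h * (\<delta>\<^sub>h / 2 + \<delta> \<tau>))) = 2 * (l * \<delta> \<tau> * \<delta>\<^sub>h) + l * \<delta>\<^sub>h * \<delta>\<^sub>h"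
    by (simp add: algebra_simps)
  ultimately show ?thesis unfolding eq l_def[symmetric] by linarith
qed

lemma misfit_integrable:
  assumes t: "t \<in> {0..T}" and \<eta>: "continuous_on {0..t} \<eta>"
  shows "(\<lambda>\<tau>. misfit \<tau> (\<eta> \<tau>)) integrable_on {0..t}"
  unfolding misfit_def
  by (rule square_integrable_quadratic_form[OF square_integrable_diff[OF
        square_integrable_subset[OF y_square_integrable] continuous_square_integrable[OF \<eta>]]])
     (use t in auto)

lemma integral_misfit_perturbation:
  assumes t: "t \<in> {0..T}" and x: "continuous_on {0..t} x"
  shows "\<bar>1/2 * integral {0..t} (\<lambda>\<tau>. misfit \<tau> (C *v \<Phi> (x \<tau>)))
          - 1/2 * integral {0..t} (\<lambda>\<tau>. misfit \<tau> (h (x \<tau>)))\<bar> \<le> err t"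
proof -
  have iC: "(\<lambda>\<tau>. misfit \<tau> (C *v \<Phi> (x \<tau>))) integrable_on {0..t}"
    by (intro misfit_integrable t continuous_intros continuous_on_compose2[OF cont_\<Phi>[of UNIV] x]) auto
  have ih: "(\<lambda>\<tau>. misfit \<tau> (h (x \<tau>))) integrable_on {0..t}"
    by (intro misfit_integrable t continuous_on_compose2[OF cont_h x]) auto
  let ?b = "\<lambda>\<tau>. \<delta>\<^sub>h * (\<delta>\<^sub>h / 2 + \<delta> \<tau>)"
  have "\<delta> integrable_on {0..t}" using t by (intro integrable_subinterval_real[OF \<delta>_int]) auto
  then have ib: "?b integrable_on {0..t}"
    by (intro integrable_on_mult_right integrable_add) auto
  have "norm (integral {0..t} (\<lambda>\<tau>. misfit \<tau> (C *v \<Phi> (x \<tau>)) - misfit \<tau> (h (x \<tau>))))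
      \<le> integral {0..t} (\<lambda>\<tau>. 2 * (lambda_max (matrix_inv Q) * ?b \<tau>))"
    by (rule integral_norm_bound_integral)
       (use t misfit_perturbation in \<open>auto intro!: integrable_diff iC ih integrable_on_mult_right ib simp del: integrable_on_cmult_iff integrable_on_mult_right_iff\<close>)
  then show ?thesis
    by (simp add: integral_diff[OF iC ih] err_def abs_le_iff)
qed

lemma running_cost_eq:
  "running_cost h y \<Phi> R Q u x \<tau>
     = (J (x \<tau>) *v u \<tau>) \<bullet> (matrix_inv R *v (J (x \<tau>) *v u \<tau>)) + misfit \<tau> (h (x \<tau>))"
  by (simp add: running_cost_def R1_quadratic misfit_def)

lemma cost_eq:
  assumes q: "(\<lambda>\<tau>. (J (x \<tau>) *v u \<tau>) \<bullet> (matrix_inv R *v (J (x \<tau>) *v u \<tau>))) integrable_on {0..t}"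
    and m: "(\<lambda>\<tau>. misfit \<tau> (h (x \<tau>))) integrable_on {0..t}"
  shows "cost h y \<Phi> R Q \<Sigma> \<mu> t u x = v 0 (\<Phi> (x 0))
      + 1/2 * integral {0..t} (\<lambda>\<tau>. (J (x \<tau>) *v u \<tau>) \<bullet> (matrix_inv R *v (J (x \<tau>) *v u \<tau>)))
      + 1/2 * integral {0..t} (\<lambda>\<tau>. misfit \<tau> (h (x \<tau>)))"
proof -
  have "running_cost h y \<Phi> R Q u x
      = (\<lambda>\<tau>. (J (x \<tau>) *v u \<tau>) \<bullet> (matrix_inv R *v (J (x \<tau>) *v u \<tau>)) + misfit \<tau> (h (x \<tau>)))"
    by (rule ext) (rule running_cost_eq)
  then show ?thesis
    unfolding cost_def v_initial by (simp add: integral_add[OF q m])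
qed

text \<open>Along any admissible trajectory the identity for \<open>v\<close> loses only a nonnegative square. Finiteness of the cost is what
makes the control square integrable, first through \<open>R1\<close> in the original coordinates, which gives an absolutely continuous
trajectory, and then through \<open>R\<inverse>\<close> in the new ones.\<close>

lemma cost_lower_bound:
  assumes t: "t \<in> {0..T}" and sol: "integral_solution t (\<lambda>\<tau>. f (x \<tau>) + u \<tau>) x"
    and fin: "running_cost h y \<Phi> R Q u x integrable_on {0..t}"
  shows "v t (\<Phi> (x t)) \<le> cost h y \<Phi> R Q \<Sigma> \<mu> t u x + err t"
proof -
  have t0: "0 \<le> t" using t by simp
  have path: "((\<lambda>\<tau>. f (x \<tau>) + u \<tau>) has_integral (x \<tau> - x 0)) {0..\<tau>}" if "\<tau> \<in> {0..t}" for \<tau>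
    using sol that by (simp add: integral_solution_def)
  have cx: "continuous_on {0..t} x" by (rule path_continuous[OF path])
  have cfx: "continuous_on {0..t} (\<lambda>\<tau>. f (x \<tau>))" and chx: "continuous_on {0..t} (\<lambda>\<tau>. h (x \<tau>))"
    and cJx: "continuous_on {0..t} (\<lambda>\<tau>. J (x \<tau>))" and c\<Phi>x: "continuous_on {0..t} (\<lambda>\<tau>. \<Phi> (x \<tau>))"
    using continuous_on_compose2[OF cont_f cx] continuous_on_compose2[OF cont_h cx]
      continuous_on_compose2[OF cont_J[of UNIV] cx] continuous_on_compose2[OF cont_\<Phi>[of UNIV] cx] by auto
  define w where "w = (\<lambda>\<tau>. J (x \<tau>) *v u \<tau>)"
  define z where "z = (\<lambda>\<tau>. \<Phi> (x \<tau>))"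
  have im: "(\<lambda>\<tau>. misfit \<tau> (h (x \<tau>))) integrable_on {0..t}" by (rule misfit_integrable[OF t chx])
  have imC: "(\<lambda>\<tau>. misfit \<tau> (C *v z \<tau>)) integrable_on {0..t}"
    unfolding z_def by (intro misfit_integrable t continuous_intros c\<Phi>x)
  have iq: "(\<lambda>\<tau>. w \<tau> \<bullet> (matrix_inv R *v w \<tau>)) integrable_on {0..t}"
  proof -
    have "(\<lambda>\<tau>. running_cost h y \<Phi> R Q u x \<tau> - misfit \<tau> (h (x \<tau>))) integrable_on {0..t}"
      by (rule integrable_diff[OF fin im])
    then show ?thesis by (simp add: running_cost_eq w_def)
  qed
  have u_meas: "u \<in> borel_measurable (lebesgue_on {0..t})"
  proof -
    have "(\<lambda>\<tau>. f (x \<tau>) + u \<tau>) integrable_on {0..t}" using path[of t] t0 by auto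
    then have "(\<lambda>\<tau>. f (x \<tau>) + u \<tau>) \<in> borel_measurable (lebesgue_on {0..t})"
      by (rule integrable_imp_measurable)
    moreover have "(\<lambda>\<tau>. f (x \<tau>)) \<in> borel_measurable (lebesgue_on {0..t})"
      using continuous_square_integrable[OF cfx] by (simp add: square_integrable_on_def)
    ultimately have "(\<lambda>\<tau>. (f (x \<tau>) + u \<tau>) - f (x \<tau>)) \<in> borel_measurable (lebesgue_on {0..t})"
      by (rule borel_measurable_diff)
    then show ?thesis by simp
  qed
  have u: "u square_integrable_on {0..t}"
  proof -
    obtain k where k: "k > 0" "\<And>\<tau> u. \<tau> \<in> {0..t} \<Longrightarrow> k * (norm u)\<^sup>2 \<le> u \<bullet> (R1 \<Phi> R (x \<tau>) *v u)"
      using R1_coercive_along_path[OF cx] by metis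
    show ?thesis
    proof (rule square_integrable_dominated[OF u_meas])
      show "(\<lambda>\<tau>. (1/k) * (w \<tau> \<bullet> (matrix_inv R *v w \<tau>))) integrable_on {0..t}"
        by (intro integrable_on_mult_right iq)
      fix \<tau> assume "\<tau> \<in> {0..t}"
      from k(2)[OF this, of "u \<tau>"] show "(norm (u \<tau>))\<^sup>2 \<le> (1/k) * (w \<tau> \<bullet> (matrix_inv R *v w \<tau>))"
        using k(1) by (simp add: R1_quadratic w_def field_simps)
    qed
  qed
  have w: "w square_integrable_on {0..t}"
  proof -
    obtain k where k: "k > 0" "\<And>v. k * (norm v)\<^sup>2 \<le> v \<bullet> (matrix_inv R *v v)"
      using pos_def_coercive[OF Ri] by metis
    have "(\<lambda>\<tau>. J (x \<tau>)) \<in> borel_measurable (lebesgue_on {0..t})"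
      using continuous_square_integrable[OF cJx] by (simp add: square_integrable_on_def)
    then have w_meas: "w \<in> borel_measurable (lebesgue_on {0..t})"
      unfolding w_def using u_meas bounded_bilinear_matrix_vector
      by (intro borel_measurable_bilinear[where h = "\<lambda>A v. A *v v"])
         (auto simp: bilinear_conv_bounded_bilinear)
    show ?thesis
    proof (rule square_integrable_dominated[OF w_meas])
      show "(\<lambda>\<tau>. (1/k) * (w \<tau> \<bullet> (matrix_inv R *v w \<tau>))) integrable_on {0..t}"
        by (intro integrable_on_mult_right iq)
      show "(norm (w \<tau>))\<^sup>2 \<le> (1/k) * (w \<tau> \<bullet> (matrix_inv R *v w \<tau>))" for \<tau>
        using k(1) k(2)[of "w \<tau>"] by (simp add: field_simps)
    qed
  qed
  have g: "(\<lambda>\<tau>. f (x \<tau>) + u \<tau>) absolutely_integrable_on {0..t}"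
    by (intro set_integral_add(1) absolutely_integrable_continuous_real cfx square_integrable_absolutely u)
  have "integral_solution t (\<lambda>\<tau>. \<Lambda> *v z \<tau> + w \<tau>) z"
    unfolding integral_solution_def
  proof
    fix \<tau> assume \<tau>: "\<tau> \<in> {0..t}"
    have "((\<lambda>\<sigma>. J (x \<sigma>) *v (f (x \<sigma>) + u \<sigma>)) has_integral (\<Phi> (x \<tau>) - \<Phi> (x 0))) {0..\<tau>}"
    proof (rule has_integral_chain_rule[where G = \<Phi> and G' = "\<lambda>x v. J x *v v" and x = x
          and g = "\<lambda>\<sigma>. f (x \<sigma>) + u \<sigma>" and a = 0 and b = \<tau>])
      show "(\<lambda>\<sigma>. f (x \<sigma>) + u \<sigma>) absolutely_integrable_on {0..\<tau>}"
        by (rule set_integrable_subset[OF g]) (use \<tau> in auto)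
      show "continuous_on UNIV (\<lambda>x. J x *v v)" for v by (intro continuous_intros cont_J)
    qed (use \<tau> path der_\<Phi> in auto)
    then show "((\<lambda>\<sigma>. \<Lambda> *v z \<sigma> + w \<sigma>) has_integral (z \<tau> - z 0)) {0..\<tau>}"
      by (simp add: z_def w_def matrix_vector_right_distrib koopman)
  qed
  from verification[OF t this w]
  have "v t (z t) - v 0 (z 0)
      \<le> integral {0..t} (\<lambda>\<tau>. 1/2 * misfit \<tau> (C *v z \<tau>) + 1/2 * (w \<tau> \<bullet> (matrix_inv R *v w \<tau>)))"
  proof (rule has_integral_le)
    show "((\<lambda>\<tau>. 1/2 * misfit \<tau> (C *v z \<tau>) + 1/2 * (w \<tau> \<bullet> (matrix_inv R *v w \<tau>))) has_integral
        integral {0..t} (\<lambda>\<tau>. 1/2 * misfit \<tau> (C *v z \<tau>) + 1/2 * (w \<tau> \<bullet> (matrix_inv R *v w \<tau>)))) {0..t}"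
      by (intro integrable_integral integrable_add integrable_on_mult_right imC iq)
  qed (use pos_def_nonneg[OF Ri] in auto)
  also have "\<dots> = 1/2 * integral {0..t} (\<lambda>\<tau>. misfit \<tau> (C *v z \<tau>))
      + 1/2 * integral {0..t} (\<lambda>\<tau>. w \<tau> \<bullet> (matrix_inv R *v w \<tau>))"
    by (subst integral_add) (intro integrable_on_mult_right imC iq, simp)+
  finally show ?thesis
    using cost_eq[OF iq[unfolded w_def] im] integral_misfit_perturbation[OF t cx]
    unfolding z_def w_def by linarith
qed

text \<open>The optimal feedback of the linear-quadratic problem, run backwards from the prescribed final state. The square in the
identity for \<open>v\<close> vanishes, so its linear-quadratic cost is exactly \<open>v t (\<Phi> \<xi>)\<close>.\<close>

lemma near_optimal_control:
  assumes t: "t \<in> {0..T}"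
  obtains u x where "integral_solution t (\<lambda>\<tau>. f (x \<tau>) + u \<tau>) x" and "x t = \<xi>"
    and "running_cost h y \<Phi> R Q u x integrable_on {0..t}"
    and "cost h y \<Phi> R Q \<Sigma> \<mu> t u x \<le> v t (\<Phi> \<xi>) + err t"
proof -
  have sub: "{0..t} \<subseteq> {0..T}" using t by auto
  have cP: "continuous_on {0..t} P" and cs: "continuous_on {0..t} s"
    using continuous_on_subset[OF cont_P sub] continuous_on_subset[OF cont_s sub] .
  \<comment> \<open>The closed loop \<open>z' = \<Lambda> z + R (P z + s)\<close>.\<close>
  define A where "A = (\<lambda>\<tau>. \<Lambda> + R ** P \<tau>)"
  have cA: "continuous_on {0..t} A" unfolding A_def by (intro continuous_intros cP)
  have cRs: "continuous_on {0..t} (\<lambda>\<tau>. R *v s \<tau>)" by (intro continuous_intros cs)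
  have "\<exists>M. \<forall>\<tau>\<in>{0..t}. norm (A \<tau>) \<le> M"
    using compact_imp_bounded[OF compact_continuous_image[OF cA compact_Icc]]
    unfolding bounded_iff by simp
  then obtain M where M: "\<And>\<tau>. \<tau> \<in> {0..t} \<Longrightarrow> norm (A \<tau>) \<le> M" by blast
  obtain B where B: "B > 0" "\<And>(X :: real^'n^'n) (u :: real^'n). norm (X *v u) \<le> norm X * norm u * B"
    using bounded_bilinear.pos_bounded[OF bounded_bilinear_matrix_vector] by metis
  obtain z where zt: "z t = \<Phi> \<xi>"
    and z: "\<And>\<tau>. \<tau> \<in> {0..t} \<Longrightarrow> (z has_vector_derivative A \<tau> *v z \<tau> + R *v s \<tau>) (at \<tau> within {0..t})"
  proof (rule lipschitz_ode_terminal_value[where T = t and F = "\<lambda>\<tau> v. A \<tau> *v v + R *v s \<tau>"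
        and L = "M * B" and zT = "\<Phi> \<xi>"])
    show "0 \<le> t" using t by simp
    show "continuous_on {0..t} (\<lambda>\<tau>. A \<tau> *v \<phi> \<tau> + R *v s \<tau>)" if "continuous_on {0..t} \<phi>" for \<phi>
      by (intro continuous_on_add continuous_on_matrix_vector cA that cRs)
    fix \<tau> and a b :: "real^'n" assume \<tau>: "\<tau> \<in> {0..t}"
    have "norm (A \<tau> *v (a - b)) \<le> norm (A \<tau>) * norm (a - b) * B" by (rule B(2))
    also have "\<dots> \<le> M * norm (a - b) * B" using M[OF \<tau>] B(1) by (intro mult_right_mono) auto
    finally show "norm (A \<tau> *v a + R *v s \<tau> - (A \<tau> *v b + R *v s \<tau>)) \<le> M * B * norm (a - b)"
      by (simp add: matrix_vector_mult_diff_distrib mult_ac)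
  qed blast
  define w where "w = (\<lambda>\<tau>. R *v (P \<tau> *v z \<tau> + s \<tau>))"
  have rhs: "A \<tau> *v z \<tau> + R *v s \<tau> = \<Lambda> *v z \<tau> + w \<tau>" for \<tau>
    by (simp add: A_def w_def matrix_vector_mult_add_rdistrib matrix_vector_right_distrib matrix_vector_mul_assoc)
  note z = z[unfolded rhs]
  have cz: "continuous_on {0..t} z" by (rule continuous_on_vector_derivative[OF z])
  have cw: "continuous_on {0..t} w" unfolding w_def by (intro continuous_intros cP cs cz)
  have ftc: "integral_solution t g' g"
    if "\<And>\<tau>. \<tau> \<in> {0..t} \<Longrightarrow> (g has_vector_derivative g' \<tau>) (at \<tau> within {0..t})" for g g' :: "real \<Rightarrow> real^'n"
    unfolding integral_solution_def
    by (intro ballI fundamental_theorem_of_calculus has_vector_derivative_within_subset[OF that]) auto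
  define x where "x = (\<lambda>\<tau>. inv \<Phi> (z \<tau>))"
  define u where "u = (\<lambda>\<tau>. matrix_inv (J (x \<tau>)) *v w \<tau>)"
  have \<Phi>x: "\<Phi> (x \<tau>) = z \<tau>" for \<tau> using bij_\<Phi> by (simp add: x_def bij_is_surj surj_f_inv_f)
  have Ju: "J (x \<tau>) *v u \<tau> = w \<tau>" for \<tau> by (simp add: u_def matrix_inv_cancel[OF inv_J])
  have dx: "(x has_vector_derivative f (x \<tau>) + u \<tau>) (at \<tau> within {0..t})" if \<tau>: "\<tau> \<in> {0..t}" for \<tau>
  proof -
    have "(inv \<Phi> has_derivative (\<lambda>v. matrix_inv (J (x \<tau>)) *v v)) (at (z \<tau>))"
      unfolding x_def by (rule inverse_has_derivative[OF der_\<Phi> inv_J bij_\<Phi>])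
    then have "(inv \<Phi> has_derivative (\<lambda>v. matrix_inv (J (x \<tau>)) *v v)) (at (z \<tau>) within z ` {0..t})"
      by (rule has_derivative_at_withinI)
    from vector_derivative_diff_chain_within[OF z[OF \<tau>] this]
    have "(x has_vector_derivative matrix_inv (J (x \<tau>)) *v (\<Lambda> *v z \<tau> + w \<tau>)) (at \<tau> within {0..t})"
      by (simp add: x_def o_def)
    moreover have "\<Lambda> *v z \<tau> + w \<tau> = J (x \<tau>) *v (f (x \<tau>) + u \<tau>)"
      by (simp add: matrix_vector_right_distrib koopman \<Phi>x Ju)
    ultimately show ?thesis by (simp only: matrix_inv_cancel[OF inv_J])
  qed
  have cx: "continuous_on {0..t} x" by (rule continuous_on_vector_derivative[OF dx])
  have iq: "(\<lambda>\<tau>. w \<tau> \<bullet> (matrix_inv R *v w \<tau>)) integrable_on {0..t}"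
    by (intro integrable_continuous_real continuous_intros cw)
  have im: "(\<lambda>\<tau>. misfit \<tau> (h (x \<tau>))) integrable_on {0..t}"
    by (rule misfit_integrable[OF t continuous_on_compose2[OF cont_h cx]]) auto
  have imC: "(\<lambda>\<tau>. misfit \<tau> (C *v z \<tau>)) integrable_on {0..t}"
    by (intro misfit_integrable t continuous_intros cz)
  have "((\<lambda>\<tau>. 1/2 * misfit \<tau> (C *v z \<tau>) + 1/2 * (w \<tau> \<bullet> (matrix_inv R *v w \<tau>)))
      has_integral (v t (z t) - v 0 (z 0))) {0..t}"
    using verification[OF t ftc[OF z] continuous_square_integrable[OF cw]] by (simp add: w_def)
  then have "v t (z t) - v 0 (z 0)
      = integral {0..t} (\<lambda>\<tau>. 1/2 * misfit \<tau> (C *v z \<tau>) + 1/2 * (w \<tau> \<bullet> (matrix_inv R *v w \<tau>)))"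
    by (simp only: integral_unique)
  also have "\<dots> = 1/2 * integral {0..t} (\<lambda>\<tau>. misfit \<tau> (C *v z \<tau>))
      + 1/2 * integral {0..t} (\<lambda>\<tau>. w \<tau> \<bullet> (matrix_inv R *v w \<tau>))"
    by (subst integral_add) (intro integrable_on_mult_right imC iq, simp)+
  finally have val: "v t (\<Phi> \<xi>) - v 0 (z 0) = 1/2 * integral {0..t} (\<lambda>\<tau>. misfit \<tau> (C *v z \<tau>))
      + 1/2 * integral {0..t} (\<lambda>\<tau>. w \<tau> \<bullet> (matrix_inv R *v w \<tau>))" unfolding zt .
  show thesis
  proof (rule that[of x u])
    show "integral_solution t (\<lambda>\<tau>. f (x \<tau>) + u \<tau>) x" by (rule ftc[OF dx])
    show "x t = \<xi>" using bij_\<Phi> by (simp add: x_def zt bij_is_inj inv_f_f)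
    have "(\<lambda>\<tau>. running_cost h y \<Phi> R Q u x \<tau>) integrable_on {0..t}"
      unfolding running_cost_eq Ju by (rule integrable_add[OF iq im])
    then show "running_cost h y \<Phi> R Q u x integrable_on {0..t}" by simp
    show "cost h y \<Phi> R Q \<Sigma> \<mu> t u x \<le> v t (\<Phi> \<xi>) + err t"
      using cost_eq[of x u t, unfolded Ju, OF iq im] integral_misfit_perturbation[OF t cx] val
      unfolding \<Phi>x by linarith
  qed
qed

lemma value_function_close:
  assumes t: "t \<in> {0..T}"
  shows "\<bar>value_function f h y \<Phi> R Q \<Sigma> \<mu> \<xi> t - v t (\<Phi> \<xi>)\<bar> \<le> err t"
proof -
  let ?costs = "{cost h y \<Phi> R Q \<Sigma> \<mu> t u x | u x.
            integral_solution t (\<lambda>\<tau>. f (x \<tau>) + u \<tau>) x \<and> x t = \<xi> \<and>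
            running_cost h y \<Phi> R Q u x integrable_on {0..t}}"
  have lower: "v t (\<Phi> \<xi>) - err t \<le> c" if "c \<in> ?costs" for c
    using that cost_lower_bound[OF t] by force
  obtain c where c: "c \<in> ?costs" "c \<le> v t (\<Phi> \<xi>) + err t"
    using near_optimal_control[OF t, of \<xi>] by blast
  have "Inf ?costs \<le> c" by (rule cInf_lower[OF c(1)]) (rule bdd_belowI[OF lower])
  moreover have "v t (\<Phi> \<xi>) - err t \<le> Inf ?costs" by (rule cInf_greatest) (use c(1) lower in blast)+
  ultimately show ?thesis
    using c(2) unfolding value_function_def by linarith
qed

end

text \<open>Both functions grow quadratically away from their own minimizer. Evaluating each at the minimizer of the other and adding,
the unknown minimal values enter only through differences \<open>V - W\<close>, each at most \<open>c\<close>.\<close>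

lemma minimizer_distance:
  fixes xV xW :: "'a::real_normed_vector"
  assumes close: "\<And>x. \<bar>V x - W x\<bar> \<le> c"
    and V: "\<And>x. V x \<ge> V xV + \<gamma>\<^sub>V / 2 * (norm (xV - x))\<^sup>2" and \<gamma>V: "\<gamma>\<^sub>V > 0"
    and W: "\<And>x. W x \<ge> W xW + \<gamma>\<^sub>W / 2 * (norm (xW - x))\<^sup>2" and \<gamma>W: "\<gamma>\<^sub>W > 0"
  shows "norm (xV - xW) \<le> 2 * sqrt (c / min \<gamma>\<^sub>V \<gamma>\<^sub>W)"
proof -
  define m where "m = min \<gamma>\<^sub>V \<gamma>\<^sub>W"
  define d where "d = norm (xV - xW)"
  have m: "m > 0" using \<gamma>V \<gamma>W by (simp add: m_def)
  have c: "c \<ge> 0" using close[of xV] by linarith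
  have "m / 2 * d\<^sup>2 \<le> \<gamma>\<^sub>V / 2 * d\<^sup>2" "m / 2 * d\<^sup>2 \<le> \<gamma>\<^sub>W / 2 * d\<^sup>2"
    by (intro mult_right_mono; simp add: m_def)+
  moreover have "V xW \<ge> V xV + \<gamma>\<^sub>V / 2 * d\<^sup>2" "W xV \<ge> W xW + \<gamma>\<^sub>W / 2 * d\<^sup>2"
    using V[of xW] W[of xV] by (simp_all add: d_def norm_minus_commute)
  ultimately have "m * d\<^sup>2 \<le> 2 * c" using close[of xV] close[of xW] by linarith
  then have "d\<^sup>2 \<le> 2 * c / m" using m by (simp add: field_simps)
  also have "\<dots> \<le> 2\<^sup>2 * (c / m)" using c m by (simp add: field_simps)
  finally have "sqrt (d\<^sup>2) \<le> sqrt (2\<^sup>2 * (c / m))" by (rule real_sqrt_le_mono)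
  moreover have "sqrt (2\<^sup>2 * (c / m)) = 2 * sqrt (c / m)" by (simp only: real_sqrt_mult real_sqrt_abs abs_numeral)
  ultimately show ?thesis unfolding m_def[symmetric] by (simp add: d_def)
qed

text \<open>The hypotheses on \<open>\<delta>\<^sub>h\<close> and \<open>\<delta>\<close> are used as pointwise bounds. Since \<open>y 0 - h x\<close> is bounded in \<open>x\<close>, so is
\<open>h\<close>, and the bound \<open>\<delta> t\<close> exceeds \<open>norm (y t)\<close> by at most a constant; hence its integral over \<open>[0, T]\<close> exists.\<close>

theorem theorem3:
  fixes f :: "real^'n \<Rightarrow> real^'n" and h :: "real^'n \<Rightarrow> real^'p"
    and R \<Sigma> \<Lambda> :: "real^'n^'n" and Q :: "real^'p^'p" and C :: "real^'n^'p"
    and \<mu> :: "real^'n" and T :: real and y :: "real \<Rightarrow> real^'p"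
    and \<Phi> :: "real^'n \<Rightarrow> real^'n"
    and P :: "real \<Rightarrow> real^'n^'n" and s :: "real \<Rightarrow> real^'n" and r :: "real \<Rightarrow> real"
    and V V\<^sub>\<Phi> :: "real^'n \<Rightarrow> real \<Rightarrow> real"
    and xhat xhat\<^sub>\<Phi> :: "real \<Rightarrow> real^'n"
    and \<delta>\<^sub>h :: real and \<delta> c :: "real \<Rightarrow> real"
    and \<gamma> \<gamma>\<^sub>\<Phi> :: real
  assumes "smooth f" and "smooth h"
    and "hyperbolic_equilibrium f 0"
    and "pos_def R" and "pos_def Q" and "pos_def \<Sigma>"
    and "T > 0"
    and "y \<in> borel_measurable (lebesgue_on {0..T})"
    and "principal_eigenfunctions f \<Lambda> \<Phi>"
    and V_def: "\<And>x t. V x t = value_function f h y \<Phi> R Q \<Sigma> \<mu> x t"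
    and "\<not> (\<exists>A :: real^'n^'p. \<forall>x. h x = A *v \<Phi> x)"
    and "least_squares_projection h \<Phi> C"
    and "\<forall>t\<in>{0..T}. (P has_vector_derivative
           - (transpose \<Lambda> ** P t + P t ** \<Lambda> + P t ** R ** P t
              - transpose C ** matrix_inv Q ** C)) (at t within {0..T})"
    and "P 0 = matrix_inv \<Sigma>"
    and "integral_solution T
           (\<lambda>t. - (transpose \<Lambda> *v s t + (P t ** R) *v s t
                  + (transpose C ** matrix_inv Q) *v y t)) s"
    and "s 0 = - (matrix_inv \<Sigma> *v \<Phi> \<mu>)"
    and "integral_solution T
           (\<lambda>t. - (1/2 * (s t \<bullet> (R *v s t)) - 1/2 * (y t \<bullet> (matrix_inv Q *v y t)))) r"
    and "r 0 = 1/2 * (\<Phi> \<mu> \<bullet> (matrix_inv \<Sigma> *v \<Phi> \<mu>))"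
    and V\<Phi>_def: "\<And>x t. V\<^sub>\<Phi> x t = 1/2 * (\<Phi> x \<bullet> (P t *v \<Phi> x)) + s t \<bullet> \<Phi> x + r t"
    and "bdd_above (range (\<lambda>x. norm (h x - C *v \<Phi> x)))"
    and \<delta>h_def: "\<delta>\<^sub>h = (SUP x. norm (h x - C *v \<Phi> x))"
    and "\<forall>t\<in>{0..T}. bdd_above (range (\<lambda>x. norm (y t - h x)))"
    and \<delta>_def: "\<And>t. \<delta> t = (SUP x. norm (y t - h x))"
    and "\<gamma> > 0" and "\<gamma>\<^sub>\<Phi> > 0"
    and "\<forall>t\<in>{0..T}. is_arg_min (\<lambda>x. V x t) (\<lambda>_. True) (xhat t)"
    and "\<forall>t\<in>{0..T}. is_arg_min (\<lambda>x. V\<^sub>\<Phi> x t) (\<lambda>_. True) (xhat\<^sub>\<Phi> t)"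
    and "\<forall>t\<in>{0..T}. \<forall>x. V x t \<ge> V (xhat t) t + \<gamma> / 2 * (norm (xhat t - x))\<^sup>2"
    and "\<forall>t\<in>{0..T}. \<forall>x.
           V\<^sub>\<Phi> x t \<ge> V\<^sub>\<Phi> (xhat\<^sub>\<Phi> t) t + \<gamma>\<^sub>\<Phi> / 2 * (norm (xhat\<^sub>\<Phi> t - x))\<^sup>2"
    and c_def: "\<And>t. c t = lambda_max (matrix_inv Q) *
                          integral {0..t} (\<lambda>\<tau>. \<delta>\<^sub>h * (\<delta>\<^sub>h / 2 + \<delta> \<tau>))"
  shows "\<forall>t\<in>{0..T}.
           (\<forall>x. \<bar>V x t - V\<^sub>\<Phi> x t\<bar> \<le> c t) \<and>
           norm (xhat t - xhat\<^sub>\<Phi> t) \<le> 2 * sqrt (c t / min \<gamma> \<gamma>\<^sub>\<Phi>)"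
proof -
  have \<Phi>: "Ck 1 \<Phi>" "\<And>x. jacobian \<Phi> (at x) *v f x = \<Lambda> *v \<Phi> x" "inj \<Phi>"
    "\<And>x. invertible (jacobian \<Phi> (at x))"
    using \<open>principal_eigenfunctions f \<Lambda> \<Phi>\<close> by (auto simp: principal_eigenfunctions_def)
  have smooth_cont: "continuous_on UNIV F" if "smooth F" for F :: "real^'n \<Rightarrow> real^'m"
    using that Ck.simps(1) by (metis smooth_def)
  interpret eigenfunction_coordinates f h R \<Sigma> \<Lambda> Q C \<mu> T y \<Phi> P s r
    using assms(4-8,13-18) smooth_cont[OF assms(1)] smooth_cont[OF assms(2)] \<Phi>(2-4)
    by unfold_locales (simp_all add: Ck_1_jacobian[OF \<Phi>(1)])
  have V\<Phi>_eq: "V\<^sub>\<Phi> x t = v t (\<Phi> x)" for x t by (simp add: V\<Phi>_def v_def)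
  have in0: "0 \<in> {0..T}" using T by simp
  have surj: "surj \<Phi>"
    using \<open>\<gamma>\<^sub>\<Phi> > 0\<close> assms(29) in0
    by (intro surj_of_quadratic_growth[of "xhat\<^sub>\<Phi> 0" "\<gamma>\<^sub>\<Phi>"]) (simp_all flip: V\<Phi>_eq)
  have \<delta>h_le: "norm (h x - C *v \<Phi> x) \<le> \<delta>\<^sub>h" for x
    unfolding \<delta>h_def by (rule cSUP_upper[OF UNIV_I assms(20)])
  have \<delta>_le: "norm (y t - h x) \<le> \<delta> t" if "t \<in> {0..T}" for t x
    unfolding \<delta>_def using assms(22) that by (intro cSUP_upper) auto
  have "norm (h x) \<le> norm (y 0) + \<delta> 0" for x
    using norm_triangle_ineq4[of "y 0" "y 0 - h x"] \<delta>_le[OF in0, of x] by simp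
  then have "bounded (range h)" by (auto simp: bounded_iff)
  then have \<delta>_int: "\<delta> integrable_on {0..T}"
    unfolding \<delta>_def[abs_def] by (rule sup_distance_integrable[OF _ y_square_integrable])
  interpret eigenfunction_filter f h R \<Sigma> \<Lambda> Q C \<mu> T y \<Phi> P s r \<delta>\<^sub>h \<delta>
    by unfold_locales (fact surj \<delta>h_le \<delta>_le \<delta>_int)+
  have close: "\<bar>V x t - V\<^sub>\<Phi> x t\<bar> \<le> c t" if "t \<in> {0..T}" for x t
    using value_function_close[OF that, of x] by (simp add: V_def V\<Phi>_eq c_def err_def)
  moreover have "norm (xhat t - xhat\<^sub>\<Phi> t) \<le> 2 * sqrt (c t / min \<gamma> \<gamma>\<^sub>\<Phi>)" if "t \<in> {0..T}" for t
    using assms(28,29) that \<open>\<gamma> > 0\<close> \<open>\<gamma>\<^sub>\<Phi> > 0\<close>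
    by (intro minimizer_distance[where V = "\<lambda>x. V x t" and W = "\<lambda>x. V\<^sub>\<Phi> x t"] close) auto
  ultimately show ?thesis by blast
qed

end
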